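(* Let $X:=\prod_{n\in\omega}X_n$ be the countable product (with the product topology) of locally compact Abelian topological groups $X_n$, $n\in\omega$. If universally measurable sets $A,B\subset X$ are not Haar-null in $X$, then their sum $A+B:=\{a+b:a\in A,\;b\in B\}$ is Haar-open in $X$.
   Context: $\omega=\{0,1,2,\dots\}$. A Borel probability measure $\mu$ on a topological space $Y$ is called Radon if for any Borel subset $B\subset Y$ and any $\varepsilon>0$ there exists a compact set $K\subset B$ such that $\mu(B\setminus K)<\varepsilon$. A subset $A$ of a topological space $Y$ is called universally measurable if it is measurable with respect to (the completion of) any Radon $\sigma$-additive Borel probability measure on $Y$. A universally measurable subset $A$ of an Abelian topological group $X$ is called Haar-null if there exists a $\sigma$-additive Borel probability measure $\mu$ on $X$ such that $\mu(A+x)=0$ for all $x\in X$ (here $\mu(A+x)=0$ is understood with respect to the completion of $\mu$, i.e. $A+x$ is contained in a Borel set of $\mu$-measure zero). A subset $A$ of an Abelian topological group $X$ is called Haar-open if for any compact subset $K\subset X$ and any point $x\in K$ there exists a point $y\in X$ such that the set $K\cap(A+y)$ is a neighborhood of $x$ in $K$ (in the subspace topology of $K$). *)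

theory Defs
  imports "HOL-Analysis.Analysis" "HOL-Algebra.Product_Groups"
begin

(* Abelian topological groups are given by a HOL-Algebra group G (written multiplicatively)
   together with an abstract topology T on its carrier.  No separation axiom is assumed. *)

definition abelian_topological_group :: "('a, 'm) monoid_scheme \<Rightarrow> 'a topology \<Rightarrow> bool" where
  "abelian_topological_group G T \<longleftrightarrow>
     comm_group G \<and> topspace T = carrier G \<and>
     continuous_map (prod_topology T T) T (\<lambda>(x, y). x \<otimes>\<^bsub>G\<^esub> y) \<and>
     continuous_map T T (\<lambda>x. inv\<^bsub>G\<^esub> x)"

definition borel_prob_measure_on :: "'a topology \<Rightarrow> 'a measure \<Rightarrow> bool" where
  "borel_prob_measure_on T \<mu> \<longleftrightarrow>
     space \<mu> = topspace T \<and>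
     sets \<mu> = sigma_sets (topspace T) {U. openin T U} \<and>
     emeasure \<mu> (topspace T) = 1"

(* The condition K \<in> sets \<mu> is automatic when T is Hausdorff; it is needed in
   general for the measure of B - K to be meaningful. *)
definition radon_prob_measure_on :: "'a topology \<Rightarrow> 'a measure \<Rightarrow> bool" where
  "radon_prob_measure_on T \<mu> \<longleftrightarrow>
     borel_prob_measure_on T \<mu> \<and>
     (\<forall>B \<in> sets \<mu>. \<forall>\<epsilon>::real. \<epsilon> > 0 \<longrightarrow>
        (\<exists>K. compactin T K \<and> K \<in> sets \<mu> \<and> K \<subseteq> B \<and> measure \<mu> (B - K) < \<epsilon>))"

definition universally_measurable_in :: "'a topology \<Rightarrow> 'a set \<Rightarrow> bool" where
  "universally_measurable_in T A \<longleftrightarrow>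
     A \<subseteq> topspace T \<and>
     (\<forall>\<mu>. radon_prob_measure_on T \<mu> \<longrightarrow> A \<in> sets (completion \<mu>))"

(* The measure \<mu> ranges over all Borel probability measures, not only the Radon ones, so a
   translate of A need not lie in the domain of the completion of \<mu>. *)
definition haar_null :: "('a, 'm) monoid_scheme \<Rightarrow> 'a topology \<Rightarrow> 'a set \<Rightarrow> bool" where
  "haar_null G T A \<longleftrightarrow>
     universally_measurable_in T A \<and>
     (\<exists>\<mu>. borel_prob_measure_on T \<mu> \<and>
        (\<forall>x \<in> carrier G. \<exists>N \<in> null_sets \<mu>. A #>\<^bsub>G\<^esub> x \<subseteq> N))"

definition haar_open :: "('a, 'm) monoid_scheme \<Rightarrow> 'a topology \<Rightarrow> 'a set \<Rightarrow> bool" where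
  "haar_open G T A \<longleftrightarrow>
     A \<subseteq> topspace T \<and>
     (\<forall>K x. compactin T K \<and> x \<in> K \<longrightarrow>
        (\<exists>y \<in> carrier G. \<exists>U. openin (subtopology T K) U \<and> x \<in> U \<and>
           U \<subseteq> K \<inter> (A #>\<^bsub>G\<^esub> y)))"

end

(*
  Let K be compact, x a point of K and Q = x^-1 K, a compact set containing the identity.  Everything
  rests on a finite Radon measure mu on X, carried by a compact set M, and a compact L with mu(L) > 0
  such that mu(zC) >= mu(C)/2 for all closed C <= L and ALL z in Q.  Given mu, non-Haar-nullity of A is
  tested on mu restricted to L, which puts a positive part D of L inside a translate of A.
  Non-Haar-nullity of B is then tested on the inverse image of mu restricted to D, which yields a closed
  C <= D with mu(C) > 0, C inside a translate of A and C^-1 inside a translate of B.  If z in Q is close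
  to the identity, then C and zC both lie in an open set of measure less than 3/2 mu(C), so they meet and
  z lies in C C^-1.  Neither Haar measure nor Fubini's theorem is needed.

  To get mu, let V be a compact neighbourhood in one factor.  For finitely many z in V there is a discrete
  probability measure p with p(zx) >= c p(x) which is concentrated on a power of V that does not depend
  on the z's: take the law q of a sum of geometrically distributed multiples of finitely many generators
  and damp it by a weight r^|x|, where |x| is the word length with respect to V.  Polynomial growth of
  the powers of V makes the weight summable uniformly in q.  Choosing c = c_k with product at least 1/2,
  products of such measures and compactness of [0,1]^Pow(X) give a finitely additive measure on X that is
  quasi-invariant under all of Q on cylinder sets.  Its outer regularisation by open cylinders is a content
  on compact sets, which extends to a Radon measure.  The topologies need not be Hausdorff, so the compact
  sets are kept closed throughout.
*)

theory Submission
  imports Defs "HOL-Probability.Product_PMF" "HOL-Real_Asymp.Real_Asymp"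
begin

section \<open>Radon measures from regular contents\<close>

text \<open>Regular contents in the sense of Halmos, with the closed subsets of a fixed closed
  compact set \<open>M\<close> in the role of the compact sets: compact sets need not be closed or
  Borel here, these are. \<open>content_outer\<close> states regularity through values on closed
  sets alone.\<close>

locale regular_content =
  fixes T :: "'a topology" and M :: "'a set" and \<kappa> :: "'a set \<Rightarrow> ennreal"
  assumes regular: "regular_space T"
    and closedin_M: "closedin T M"
    and compactin_M: "compactin T M"
    and finite_content: "\<kappa> M < \<infinity>"
    and content_mono: "\<lbrakk>closedin T C; closedin T D; C \<subseteq> D; D \<subseteq> M\<rbrakk> \<Longrightarrow> \<kappa> C \<le> \<kappa> D"
    and content_subadd: "\<lbrakk>closedin T C; closedin T D; C \<subseteq> M; D \<subseteq> M\<rbrakk> \<Longrightarrow> \<kappa> (C \<union> D) \<le> \<kappa> C + \<kappa> D"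
    and content_add: "\<lbrakk>closedin T C; closedin T D; C \<subseteq> M; D \<subseteq> M; C \<inter> D = {}\<rbrakk>
      \<Longrightarrow> \<kappa> (C \<union> D) = \<kappa> C + \<kappa> D"
    and content_outer: "\<lbrakk>closedin T C; C \<subseteq> M; 0 < e\<rbrakk> \<Longrightarrow>
      \<exists>U. openin T U \<and> C \<subseteq> U \<and> (\<forall>D. closedin T D \<and> D \<subseteq> M \<and> D \<subseteq> U \<longrightarrow> \<kappa> D \<le> \<kappa> C + ennreal e)"
begin

section \<open>The outer measure induced by a content\<close>

definition open_content :: "'a set \<Rightarrow> ennreal" where
  "open_content W = (SUP C\<in>{C. closedin T C \<and> C \<subseteq> M \<and> C \<subseteq> W}. \<kappa> C)"

definition outer_content :: "'a set \<Rightarrow> ennreal" where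
  "outer_content B = (INF W\<in>{W. openin T W \<and> B \<subseteq> W}. open_content W)"

definition radon_measure :: "'a measure" where
  "radon_measure = measure_of (topspace T) {U. openin T U} outer_content"

lemma content_empty: "\<kappa> {} = 0"
proof -
  have "\<kappa> {} = \<kappa> {} + \<kappa> {}"
    using content_add[of "{}" "{}"] by simp
  moreover have "\<kappa> {} < \<infinity>"
    using content_mono[of "{}" M] closedin_M finite_content by (auto intro: le_less_trans)
  ultimately show ?thesis
    by (cases "\<kappa> {}") (auto simp flip: ennreal_plus)
qed

lemma closedin_subset_compact: "closedin T C \<Longrightarrow> C \<subseteq> M \<Longrightarrow> compactin T C"
  using closed_compactin compactin_M by blast

lemma open_content_upper: "closedin T C \<Longrightarrow> C \<subseteq> M \<Longrightarrow> C \<subseteq> W \<Longrightarrow> \<kappa> C \<le> open_content W"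
  unfolding open_content_def by (rule SUP_upper) auto

lemma open_content_least:
  "(\<And>C. closedin T C \<Longrightarrow> C \<subseteq> M \<Longrightarrow> C \<subseteq> W \<Longrightarrow> \<kappa> C \<le> r) \<Longrightarrow> open_content W \<le> r"
  unfolding open_content_def by (rule SUP_least) auto

lemma open_content_mono: "W \<subseteq> W' \<Longrightarrow> open_content W \<le> open_content W'"
  by (rule open_content_least) (auto intro: open_content_upper)

lemma open_content_le: "open_content W \<le> \<kappa> M"
  by (rule open_content_least) (auto intro: content_mono closedin_M)

lemma outer_content_le: "openin T W \<Longrightarrow> B \<subseteq> W \<Longrightarrow> outer_content B \<le> open_content W"
  unfolding outer_content_def by (rule INF_lower) auto

lemma outer_content_greatest:
  "(\<And>W. openin T W \<Longrightarrow> B \<subseteq> W \<Longrightarrow> r \<le> open_content W) \<Longrightarrow> r \<le> outer_content B"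
  unfolding outer_content_def by (rule INF_greatest) auto

lemma outer_content_mono: "B \<subseteq> B' \<Longrightarrow> outer_content B \<le> outer_content B'"
  by (rule outer_content_greatest) (auto intro: outer_content_le)

lemma outer_content_open: "openin T W \<Longrightarrow> outer_content W = open_content W"
  by (intro antisym outer_content_le outer_content_greatest open_content_mono) auto

text \<open>This is where regularity of the content enters: the neighbourhood from
  \<open>content_outer\<close> gives the upper bound. For the lower one, \<open>C\<close> itself
  competes in the supremum \<open>open_content W\<close> of every open \<open>W\<close> around
  it.\<close>

lemma outer_content_closed:
  assumes "closedin T C" "C \<subseteq> M" shows "outer_content C = \<kappa> C"
proof (rule antisym)
  show "\<kappa> C \<le> outer_content C"
    using assms by (auto intro!: outer_content_greatest open_content_upper)
  show "outer_content C \<le> \<kappa> C"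
  proof (rule ennreal_le_epsilon)
    fix e :: real assume "0 < e"
    from content_outer[OF assms this] obtain U where U: "openin T U" "C \<subseteq> U"
      "\<forall>D. closedin T D \<and> D \<subseteq> M \<and> D \<subseteq> U \<longrightarrow> \<kappa> D \<le> \<kappa> C + ennreal e"
      by (elim exE conjE)
    have "outer_content C \<le> open_content U"
      by (rule outer_content_le) (rule U)+
    also have "\<dots> \<le> \<kappa> C + ennreal e"
      by (rule open_content_least) (simp add: U(3))
    finally show "outer_content C \<le> \<kappa> C + ennreal e" .
  qed
qed

lemma outer_content_approx:
  assumes "B \<subseteq> topspace T" "0 < e"
  obtains W where "openin T W" "B \<subseteq> W" "open_content W \<le> outer_content B + ennreal e"
proof -
  have "outer_content B \<le> \<kappa> M"
    using outer_content_le[of "topspace T" B] assms(1) open_content_le by (metis openin_topspace order_trans)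
  then have "outer_content B < \<infinity>"
    using finite_content by (auto intro: le_less_trans)
  then have "outer_content B < outer_content B + ennreal e"
    using assms(2) by (simp add: ennreal_add_left_cancel_less)
  then obtain W where "openin T W" "B \<subseteq> W" "open_content W < outer_content B + ennreal e"
    unfolding outer_content_def INF_less_iff by auto
  then show thesis using that by force
qed

text \<open>For closed \<open>C\<close> inside \<open>V \<union> W\<close>, the disjoint sets
  \<open>C - V\<close> and \<open>C - W\<close> have disjoint neighbourhoods \<open>U\<close> and
  \<open>U'\<close>. Hence \<open>C\<close> is the union of the closed sets \<open>C - U\<close>,
  inside \<open>V\<close>, and \<open>C - U'\<close>, inside \<open>W\<close>.\<close>

lemma open_content_Un:
  assumes "openin T V" "openin T W"
  shows "open_content (V \<union> W) \<le> open_content V + open_content W"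
proof (rule open_content_least)
  fix C assume C: "closedin T C" "C \<subseteq> M" "C \<subseteq> V \<union> W"
  have cl: "closedin T (C - V)" "closedin T (C - W)"
    using C assms by (auto intro: closedin_diff)
  moreover have "compactin T (C - V)"
    using cl C by (auto intro: closedin_subset_compact)
  ultimately obtain U U' where U: "openin T U" "openin T U'" "C - V \<subseteq> U" "C - W \<subseteq> U'" "disjnt U U'"
    using regular_space_compact_closed_separation[OF regular, of "C - V" "C - W"] C
    unfolding disjnt_def by blast
  have cl': "closedin T (C - U)" "closedin T (C - U')"
    using C U by (auto intro: closedin_diff)
  have "\<kappa> C = \<kappa> ((C - U) \<union> (C - U'))"
    using U by (intro arg_cong[where f=\<kappa>]) (auto simp: disjnt_iff)
  also have "\<dots> \<le> \<kappa> (C - U) + \<kappa> (C - U')"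
    using cl' C by (intro content_subadd) auto
  also have "\<dots> \<le> open_content V + open_content W"
    using cl' C U by (intro add_mono open_content_upper) auto
  finally show "\<kappa> C \<le> open_content V + open_content W" .
qed

lemma open_content_UN_finite:
  assumes "finite I" "\<And>i. i \<in> I \<Longrightarrow> openin T (W i)"
  shows "open_content (\<Union>i\<in>I. W i) \<le> (\<Sum>i\<in>I. open_content (W i))"
  using assms
proof (induction I)
  case empty
  have "open_content {} \<le> 0" by (rule open_content_least) (simp add: content_empty)
  then show ?case by simp
next
  case (insert i I)
  have "open_content (\<Union>i\<in>insert i I. W i) \<le> open_content (W i) + open_content (\<Union>i\<in>I. W i)"
    using insert.prems by (auto intro!: open_content_Un)
  also have "\<dots> \<le> open_content (W i) + (\<Sum>i\<in>I. open_content (W i))"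
    using insert by (intro add_left_mono) auto
  finally show ?case using insert by simp
qed

text \<open>The closed sets in the supremum are compact, so each meets only a finite subcover and
  finite subadditivity suffices.\<close>

lemma open_content_UN:
  assumes "\<And>i. openin T (W i)"
  shows "open_content (\<Union>i. W i) \<le> (\<Sum>i::nat. open_content (W i))"
proof (rule open_content_least)
  fix C assume C: "closedin T C" "C \<subseteq> M" "C \<subseteq> (\<Union>i. W i)"
  then have "compactin T C" by (auto intro: closedin_subset_compact)
  then obtain F where F: "finite F" "F \<subseteq> range W" "C \<subseteq> \<Union>F"
    using C(3) assms compactinD[of T C "range W"] by blast
  then obtain I where I: "finite I" "F = W ` I"
    by (meson finite_subset_image)
  have "\<kappa> C \<le> open_content (\<Union>i\<in>I. W i)"
    using C F I by (auto intro!: open_content_upper)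
  also have "\<dots> \<le> (\<Sum>i\<in>I. open_content (W i))"
    by (intro open_content_UN_finite I assms)
  also have "\<dots> \<le> (\<Sum>i. open_content (W i))"
    by (intro sum_le_suminf I) auto
  finally show "\<kappa> C \<le> (\<Sum>i. open_content (W i))" .
qed

section \<open>Caratheodory extension to the Borel sets\<close>

lemma outer_measure_space_outer_content: "outer_measure_space (Pow (topspace T)) outer_content"
  unfolding outer_measure_space_def
proof (intro conjI)
  show "positive (Pow (topspace T)) outer_content"
    unfolding positive_def using outer_content_closed[of "{}"] content_empty by auto
  show "increasing (Pow (topspace T)) outer_content"
    unfolding increasing_def by (auto intro: outer_content_mono)
  show "countably_subadditive (Pow (topspace T)) outer_content"
    unfolding countably_subadditive_def
  proof safe
    fix A :: "nat \<Rightarrow> 'a set" assume A: "range A \<subseteq> Pow (topspace T)"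
    show "outer_content (\<Union>i. A i) \<le> (\<Sum>i. outer_content (A i))"
    proof (rule ennreal_le_epsilon)
      fix e :: real assume e: "0 < e"
      have "\<exists>W. openin T W \<and> A n \<subseteq> W \<and>
          open_content W \<le> outer_content (A n) + ennreal (e * (1/2)^Suc n)" for n
      proof -
        have "A n \<subseteq> topspace T" "0 < e * (1/2)^Suc n" using A e by auto
        from outer_content_approx[OF this] show ?thesis by blast
      qed
      then obtain W where W: "\<And>n. openin T (W n)" "\<And>n. A n \<subseteq> W n"
        "\<And>n. open_content (W n) \<le> outer_content (A n) + ennreal (e * (1/2)^Suc n)"
        by metis
      have "outer_content (\<Union>i. A i) \<le> open_content (\<Union>i. W i)"
        using W by (auto intro!: outer_content_le)
      also have "\<dots> \<le> (\<Sum>i. open_content (W i))"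
        by (rule open_content_UN) (rule W)
      also have "\<dots> \<le> (\<Sum>n. outer_content (A n) + ennreal (e * (1/2)^Suc n))"
        by (intro suminf_le W allI) auto
      also have "\<dots> = (\<Sum>n. outer_content (A n)) + (\<Sum>n. ennreal e * ennreal ((1/2) ^ Suc n))"
        using e by (subst suminf_add[symmetric])
                   (auto simp del: ennreal_suminf_cmult simp add: ennreal_mult[symmetric])
      also have "\<dots> = (\<Sum>n. outer_content (A n)) + ennreal e"
        unfolding ennreal_suminf_cmult
        by (subst suminf_ennreal_eq[OF zero_le_power power_half_series]) auto
      finally show "outer_content (\<Union>i. A i) \<le> (\<Sum>n. outer_content (A n)) + ennreal e" .
    qed
  qed
qed

text \<open>Exhaust \<open>W \<inter> V\<close> by closed sets \<open>C\<close>, then the open set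
  \<open>W - C\<close>, which contains \<open>W - V\<close>, by closed sets \<open>D\<close>. Then
  \<open>C\<close> and \<open>D\<close> are disjoint, and additivity of the content applies to
  \<open>C \<union> D\<close> inside \<open>W\<close>.\<close>

lemma outer_content_split:
  assumes "openin T V" "openin T W"
  shows "outer_content (W \<inter> V) + outer_content (W - V) \<le> open_content W"
proof -
  have ne: "{C. closedin T C \<and> C \<subseteq> M \<and> C \<subseteq> N} \<noteq> {}" for N
    by (rule ex_in_conv[THEN iffD1], rule exI[of _ "{}"]) auto
  have *: "\<kappa> C + outer_content (W - V) \<le> open_content W"
    if C: "closedin T C" "C \<subseteq> M" "C \<subseteq> W \<inter> V" for C
  proof -
    have "outer_content (W - V) \<le> open_content (W - C)"
      using C assms by (intro outer_content_le) (auto intro: openin_diff)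
    then have "\<kappa> C + outer_content (W - V) \<le> \<kappa> C + open_content (W - C)"
      by (rule add_left_mono)
    also have "\<dots> = (SUP D\<in>{D. closedin T D \<and> D \<subseteq> M \<and> D \<subseteq> W - C}. \<kappa> C + \<kappa> D)"
      unfolding open_content_def by (rule ennreal_SUP_add_right) (rule ne)
    also have "\<dots> \<le> open_content W"
    proof (rule SUP_least)
      fix D assume "D \<in> {D. closedin T D \<and> D \<subseteq> M \<and> D \<subseteq> W - C}"
      then have D: "closedin T D" "D \<subseteq> M" "D \<subseteq> W - C" by auto
      then have "\<kappa> C + \<kappa> D = \<kappa> (C \<union> D)"
        using C by (intro content_add[symmetric]) auto
      also have "\<dots> \<le> open_content W"
        using C D by (intro open_content_upper) auto
      finally show "\<kappa> C + \<kappa> D \<le> open_content W" .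
    qed
    finally show ?thesis .
  qed
  have "outer_content (W \<inter> V) + outer_content (W - V) = open_content (W \<inter> V) + outer_content (W - V)"
    using assms by (simp add: outer_content_open openin_Int)
  also have "\<dots> = (SUP C\<in>{C. closedin T C \<and> C \<subseteq> M \<and> C \<subseteq> W \<inter> V}. \<kappa> C + outer_content (W - V))"
    unfolding open_content_def by (rule ennreal_SUP_add_left[symmetric]) (rule ne)
  also have "\<dots> \<le> open_content W"
    by (rule SUP_least) (use * in auto)
  finally show ?thesis .
qed

text \<open>The Caratheodory-measurable sets form a sigma-algebra, so open sets \<open>V\<close> are
  enough. A test set \<open>B\<close> is first enlarged to an open \<open>W\<close>, where
  \<open>outer_content_split\<close> applies.\<close>

lemma borel_subset_lambda_system:
  "sigma_sets (topspace T) {U. openin T U} \<subseteq> lambda_system (topspace T) (Pow (topspace T)) outer_content"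
proof -
  interpret P: sigma_algebra "topspace T" "Pow (topspace T)" by (rule sigma_algebra_Pow)
  note oms = outer_measure_space_outer_content
  interpret L: sigma_algebra "topspace T" "lambda_system (topspace T) (Pow (topspace T)) outer_content"
    using P.caratheodory_lemma[OF oms] by (simp add: measure_space_def)
  show ?thesis
  proof (rule L.sigma_sets_subset, safe)
    fix V assume V: "openin T V"
    show "V \<in> lambda_system (topspace T) (Pow (topspace T)) outer_content"
      unfolding P.lambda_system_eq
    proof safe
      show "x \<in> topspace T" if "x \<in> V" for x using that V openin_subset by auto
      fix B assume B: "B \<subseteq> topspace T"
      show "outer_content (B \<inter> V) + outer_content (B - V) = outer_content B"
      proof (rule antisym)
        show "outer_content (B \<inter> V) + outer_content (B - V) \<le> outer_content B"
        proof (rule outer_content_greatest)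
          fix W assume W: "openin T W" "B \<subseteq> W"
          have "outer_content (B \<inter> V) + outer_content (B - V)
              \<le> outer_content (W \<inter> V) + outer_content (W - V)"
            using W by (intro add_mono outer_content_mono) auto
          also have "\<dots> \<le> open_content W"
            by (rule outer_content_split) fact+
          finally show "outer_content (B \<inter> V) + outer_content (B - V) \<le> open_content W" .
        qed
        show "outer_content B \<le> outer_content (B \<inter> V) + outer_content (B - V)"
        proof -
          have "subadditive (Pow (topspace T)) outer_content"
            using oms P.countably_subadditive_subadditive unfolding outer_measure_space_def by blast
          then have "outer_content ((B \<inter> V) \<union> (B - V)) \<le> outer_content (B \<inter> V) + outer_content (B - V)"
            using B by (intro subadditiveD) auto
          then show ?thesis by (simp add: Int_Diff_Un)
        qed
      qed
    qed
  qed
qed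

lemma space_radon_measure: "space radon_measure = topspace T"
  unfolding radon_measure_def by (intro space_measure_of) (auto dest: openin_subset)

lemma sets_radon_measure: "sets radon_measure = sigma_sets (topspace T) {U. openin T U}"
  unfolding radon_measure_def by (subst sets_measure_of) (auto dest: openin_subset)

lemma emeasure_radon_measure:
  assumes "B \<in> sets radon_measure" shows "emeasure radon_measure B = outer_content B"
proof -
  interpret P: sigma_algebra "topspace T" "Pow (topspace T)" by (rule sigma_algebra_Pow)
  let ?L = "lambda_system (topspace T) (Pow (topspace T)) outer_content"
  have L: "measure_space (topspace T) ?L outer_content"
    by (rule P.caratheodory_lemma[OF outer_measure_space_outer_content])
  show ?thesis
  proof (rule emeasure_measure_of[OF radon_measure_def _ _ _ assms])
    show "{U. openin T U} \<subseteq> Pow (topspace T)" by (auto dest: openin_subset)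
    show "positive (sets radon_measure) outer_content"
      using L by (auto simp: measure_space_def positive_def)
    show "countably_additive (sets radon_measure) outer_content"
      unfolding countably_additive_def
    proof safe
      fix A :: "nat \<Rightarrow> 'a set"
      assume A: "range A \<subseteq> sets radon_measure" "disjoint_family A" "(\<Union>i. A i) \<in> sets radon_measure"
      then have "range A \<subseteq> ?L" "(\<Union>i. A i) \<in> ?L"
        using borel_subset_lambda_system sets_radon_measure by blast+
      moreover have "countably_additive ?L outer_content"
        using L by (simp add: measure_space_def)
      ultimately show "(\<Sum>i. outer_content (A i)) = outer_content (\<Union>i. A i)"
        using A(2) by (simp add: countably_additive_def)
    qed
  qed
qed

lemma openin_sets_radon_measure: "openin T W \<Longrightarrow> W \<in> sets radon_measure"
  unfolding sets_radon_measure by (auto intro: sigma_sets.Basic)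

lemma closedin_sets_radon_measure: "closedin T C \<Longrightarrow> C \<in> sets radon_measure"
  using openin_sets_radon_measure[of "topspace T - C"] sets.compl_sets[of "topspace T - C" radon_measure]
  by (auto simp: space_radon_measure closedin_def double_diff)

lemma emeasure_radon_measure_closed:
  "closedin T C \<Longrightarrow> C \<subseteq> M \<Longrightarrow> emeasure radon_measure C = \<kappa> C"
  by (simp add: emeasure_radon_measure closedin_sets_radon_measure outer_content_closed)

lemma emeasure_radon_measure_outside: "emeasure radon_measure (topspace T - M) = 0"
proof -
  have op: "openin T (topspace T - M)"
    using closedin_M by (simp add: closedin_def)
  have "open_content (topspace T - M) \<le> 0"
  proof (rule open_content_least)
    fix C assume "C \<subseteq> M" "C \<subseteq> topspace T - M"
    then have "C = {}" by auto
    then show "\<kappa> C \<le> 0" by (simp add: content_empty)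
  qed
  then show ?thesis
    using op by (simp add: emeasure_radon_measure openin_sets_radon_measure outer_content_open)
qed

lemma finite_measure_radon_measure: "finite_measure radon_measure"
proof
  have "emeasure radon_measure (topspace T) = open_content (topspace T)"
    by (simp add: emeasure_radon_measure openin_sets_radon_measure outer_content_open)
  also have "\<dots> \<le> \<kappa> M" by (rule open_content_le)
  finally show "emeasure radon_measure (space radon_measure) \<noteq> \<infinity>"
    using finite_content by (auto simp: space_radon_measure top_unique)
qed

text \<open>Outer approximation of the complement of \<open>B\<close> by an open \<open>W\<close>,
  read in the complement. The resulting set is merely closed; cutting \<open>B\<close> down to a
  subset of \<open>M\<close> beforehand makes it compact.\<close>

lemma radon_measure_inner_regular:
  assumes B: "B \<in> sets radon_measure" and e: "0 < e"
  obtains C where "closedin T C" "C \<subseteq> B" "measure radon_measure (B - C) < e"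
proof -
  interpret finite_measure radon_measure by (rule finite_measure_radon_measure)
  have Bs: "B \<subseteq> topspace T"
    using B sets.sets_into_space space_radon_measure by blast
  have co: "topspace T - B \<in> sets radon_measure"
    using B by (metis sets.compl_sets space_radon_measure)
  obtain W where W: "openin T W" "topspace T - B \<subseteq> W"
    "open_content W \<le> outer_content (topspace T - B) + ennreal (e/2)"
    by (rule outer_content_approx[of "topspace T - B" "e/2"]) (use e in auto)
  have "emeasure radon_measure W \<le> emeasure radon_measure (topspace T - B) + ennreal (e/2)"
    using W co by (simp add: emeasure_radon_measure openin_sets_radon_measure outer_content_open)
  then have le: "measure radon_measure W \<le> measure radon_measure (topspace T - B) + e/2"
    using e by (simp add: emeasure_eq_measure flip: ennreal_plus)
  have "B - (topspace T - W) = W - (topspace T - B)"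
    using Bs W openin_subset[OF W(1)] by auto
  then have "measure radon_measure (B - (topspace T - W)) = measure radon_measure W - measure radon_measure (topspace T - B)"
    using W co by (simp add: finite_measure_Diff openin_sets_radon_measure)
  then have "measure radon_measure (B - (topspace T - W)) < e"
    using le e by simp
  moreover have "closedin T (topspace T - W)" using W by (simp add: closedin_def openin_subset double_diff)
  moreover have "topspace T - W \<subseteq> B" using W by auto
  ultimately show thesis using that by blast
qed

end


section \<open>Abelian topological groups\<close>

locale abelian_top_group = comm_group G for G (structure) +
  fixes T :: "'a topology"
  assumes topspace_eq: "topspace T = carrier G"
    and continuous_mult: "continuous_map (prod_topology T T) T (\<lambda>(x, y). x \<otimes> y)"
    and continuous_inv: "continuous_map T T (\<lambda>x. inv x)"

lemma abelian_top_group_iff: "abelian_top_group G T \<longleftrightarrow> abelian_topological_group G T"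
  unfolding abelian_top_group_def abelian_topological_group_def abelian_top_group_axioms_def by blast

context abelian_top_group
begin

section \<open>Translations, regularity and coverings in one group\<close>

lemma continuous_map_mult:
  assumes "continuous_map X T f" "continuous_map X T g"
  shows "continuous_map X T (\<lambda>x. f x \<otimes> g x)"
proof -
  have "continuous_map X (prod_topology T T) (\<lambda>x. (f x, g x))"
    using assms by (simp add: continuous_map_pairwise o_def)
  from continuous_map_compose[OF this continuous_mult] show ?thesis by (simp add: o_def)
qed

lemma continuous_map_inv:
  assumes "continuous_map X T f" shows "continuous_map X T (\<lambda>x. inv (f x))"
  using continuous_map_compose[OF assms continuous_inv] by (simp add: o_def)

lemma homeomorphic_map_translation:
  assumes "z \<in> carrier G" shows "homeomorphic_map T T (\<lambda>x. z \<otimes> x)"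
proof -
  have "continuous_map T T (\<lambda>x. w \<otimes> x)" if "w \<in> carrier G" for w
    by (rule continuous_map_mult) (use that in \<open>auto simp: topspace_eq\<close>)
  then have "homeomorphic_maps T T (\<lambda>x. z \<otimes> x) (\<lambda>x. inv z \<otimes> x)"
    unfolding homeomorphic_maps_def using assms by (auto simp: topspace_eq m_assoc[symmetric])
  then show ?thesis by (rule homeomorphic_maps_imp_map)
qed

lemma homeomorphic_map_inv: "homeomorphic_map T T (\<lambda>x. inv x)"
proof -
  have "homeomorphic_maps T T (\<lambda>x. inv x) (\<lambda>x. inv x)"
    unfolding homeomorphic_maps_def using continuous_inv by (auto simp: topspace_eq)
  then show ?thesis by (rule homeomorphic_maps_imp_map)
qed

lemma openin_translation_preimage:
  assumes "z \<in> carrier G" "openin T W" shows "openin T {x \<in> carrier G. z \<otimes> x \<in> W}"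
proof -
  have "continuous_map T T (\<lambda>x. z \<otimes> x)"
    using homeomorphic_map_translation[OF assms(1)] homeomorphic_imp_continuous_map by blast
  from openin_continuous_map_preimage[OF this assms(2)] show ?thesis by (simp add: topspace_eq)
qed

lemma compactin_set_mult:
  assumes "compactin T C" "compactin T D" shows "compactin T (C <#> D)"
proof -
  have "compactin (prod_topology T T) (C \<times> D)"
    using assms by (simp add: compactin_Times)
  from image_compactin[OF this continuous_mult] show ?thesis
    by (simp add: set_mult_def image_def Bex_def) (auto elim!: back_subst[of "compactin T"])
qed

text \<open>Choose \<open>U\<close> around \<open>x\<close> and \<open>V\<close> around the identity
  such that all quotients \<open>u \<otimes> inv v\<close> lie in \<open>W\<close>. If
  \<open>y\<close> is in the closure of \<open>U\<close>, then \<open>y V\<close> meets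
  \<open>U\<close>, so \<open>y\<close> is such a quotient and lies in \<open>W\<close>.\<close>

lemma regular_space: "regular_space T"
  unfolding neighbourhood_base_of_closedin[symmetric] neighbourhood_base_of
proof safe
  fix W x assume W: "openin T W" "x \<in> W"
  have x: "x \<in> carrier G" using W openin_subset topspace_eq by blast
  have "continuous_map (prod_topology T T) T (\<lambda>p. fst p \<otimes> inv (snd p))"
    by (intro continuous_map_mult continuous_map_inv continuous_map_fst continuous_map_snd)
  moreover define S where "S = {p \<in> topspace (prod_topology T T). fst p \<otimes> inv (snd p) \<in> W}"
  ultimately have "openin (prod_topology T T) S"
    using openin_continuous_map_preimage[OF _ W(1)] by blast
  moreover have "(x, \<one>) \<in> S"
    using x W by (simp add: topspace_eq S_def)
  ultimately have "\<exists>U V. openin T U \<and> openin T V \<and> x \<in> U \<and> \<one> \<in> V \<and> U \<times> V \<subseteq> S"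
    using openin_prod_topology_alt[of T T S] by simp
  then obtain U V where UV: "openin T U" "openin T V" "x \<in> U" "\<one> \<in> V" "U \<times> V \<subseteq> S"
    by blast
  have "T closure_of U \<subseteq> W"
  proof
    fix y assume y: "y \<in> T closure_of U"
    then have yc: "y \<in> carrier G" using closure_of_subset_topspace[of T U] by (auto simp: topspace_eq)
    define N where "N = (\<lambda>v. y \<otimes> v) ` V"
    have "openin T N" unfolding N_def
      using homeomorphic_map_openness_eq[OF homeomorphic_map_translation[OF yc]] UV openin_subset by blast
    moreover have "y \<in> N" unfolding N_def using UV yc by (intro image_eqI[of _ _ \<one>]) auto
    ultimately have "\<exists>u. u \<in> U \<and> u \<in> N" using y by (auto simp: in_closure_of)
    then obtain u where u: "u \<in> U" "u \<in> N" by (elim exE conjE)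
    then obtain v where v: "v \<in> V" "u = y \<otimes> v" unfolding N_def by blast
    have vc: "v \<in> carrier G" using v UV openin_subset topspace_eq by blast
    have "u \<otimes> inv v \<in> W" using UV(5) u v unfolding S_def by auto
    then show "y \<in> W" using v vc yc by (simp add: m_assoc)
  qed
  then show "\<exists>U V. openin T U \<and> closedin T V \<and> x \<in> U \<and> U \<subseteq> V \<and> V \<subseteq> W"
    using UV closure_of_subset[of U T] openin_subset[of T U] by (intro exI[of _ U] exI[of _ "T closure_of U"]) auto
qed

text \<open>The device for keeping compact sets closed: compact sets are enlarged to closed compact
  ones.\<close>

lemma compact_subset_closed_compact:
  assumes "locally_compact_space T" "compactin T C"
  obtains D where "compactin T D" "closedin T D" "C \<subseteq> D"
  using assms locally_compact_space_compact_closed_compact[of T] regular_space by (meson order_trans)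

text \<open>The tube lemma for the preimage of \<open>W\<close> under multiplication, an open set
  that contains \<open>{\<one>} \<times> C\<close>.\<close>

lemma small_translates:
  assumes C: "compactin T C" and W: "openin T W" "C \<subseteq> W"
  obtains N where "openin T N" "\<one> \<in> N" "\<forall>z\<in>N. \<forall>c\<in>C. z \<otimes> c \<in> W"
proof -
  have op: "openin (prod_topology T T) {p \<in> topspace (prod_topology T T). (case p of (x, y) \<Rightarrow> x \<otimes> y) \<in> W}"
    by (rule openin_continuous_map_preimage[OF continuous_mult W(1)])
  have "C \<subseteq> carrier G" using C compactin_subset_topspace topspace_eq by blast
  then have sub: "{\<one>} \<times> C \<subseteq> {p \<in> topspace (prod_topology T T). (case p of (x, y) \<Rightarrow> x \<otimes> y) \<in> W}"
    using W by (auto simp: topspace_eq subset_iff)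
  have "\<one> \<in> topspace T" by (simp add: topspace_eq)
  from tube_lemma_right[OF op C this sub] obtain N V where NV: "openin T N" "\<one> \<in> N" "C \<subseteq> V"
    "N \<times> V \<subseteq> {p \<in> topspace (prod_topology T T). (case p of (x, y) \<Rightarrow> x \<otimes> y) \<in> W}"
    by (elim exE conjE)
  show thesis
  proof (rule that[OF NV(1,2)], intro ballI)
    fix z c assume "z \<in> N" "c \<in> C"
    then have "(z, c) \<in> N \<times> V" using NV(3) by auto
    then show "z \<otimes> c \<in> W" using NV(4) by auto
  qed
qed

text \<open>\<open>V\<close> is \<open>Q\<close> together with a compact neighbourhood
  \<open>L\<close> of the identity. The compact set \<open>V <#> V\<close> is covered by finitely
  many translates of an open \<open>U \<subseteq> V\<close>. This doubling property is the source of
  the polynomial growth used below.\<close>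

lemma compact_covering:
  assumes lc: "locally_compact_space T" and Q: "compactin T Q"
  obtains V F where "compactin T V" "Q \<subseteq> V" "\<one> \<in> V" "finite F" "F \<subseteq> carrier G" "V <#> V \<subseteq> V <#> F"
proof -
  obtain U L where UL: "openin T U" "compactin T L" "\<one> \<in> U" "U \<subseteq> L"
    using lc unfolding locally_compact_space_def topspace_eq by blast
  define V where "V = Q \<union> L"
  have V: "compactin T V" unfolding V_def using UL Q by (simp add: compactin_Un)
  have Vc: "V \<subseteq> carrier G" using V compactin_subset_topspace topspace_eq by blast
  have VVc: "V <#> V \<subseteq> carrier G" using Vc unfolding set_mult_def by auto
  define \<U> where "\<U> = (\<lambda>f. (\<lambda>u. f \<otimes> u) ` U) ` (V <#> V)"
  have op: "\<And>N. N \<in> \<U> \<Longrightarrow> openin T N"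
  proof -
    fix N assume "N \<in> \<U>"
    then obtain f where f: "f \<in> carrier G" "N = (\<lambda>u. f \<otimes> u) ` U" using VVc unfolding \<U>_def by blast
    then show "openin T N"
      using homeomorphic_map_openness_eq[OF homeomorphic_map_translation[OF f(1)]] UL openin_subset by blast
  qed
  have cover: "V <#> V \<subseteq> \<Union>\<U>"
  proof
    fix x assume x: "x \<in> V <#> V"
    then have "x \<in> (\<lambda>u. x \<otimes> u) ` U" using UL VVc by (intro image_eqI[of _ _ \<one>]) auto
    then show "x \<in> \<Union>\<U>" using x unfolding \<U>_def by blast
  qed
  obtain \<F> where \<F>: "finite \<F>" "\<F> \<subseteq> \<U>" "V <#> V \<subseteq> \<Union>\<F>"
    using compactinD[OF compactin_set_mult[OF V V] op cover] by auto
  then obtain F where F: "finite F" "F \<subseteq> V <#> V" "\<F> = (\<lambda>f. (\<lambda>u. f \<otimes> u) ` U) ` F"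
    unfolding \<U>_def by (meson finite_subset_image)
  have Fc: "F \<subseteq> carrier G" using F VVc by blast
  have "V <#> V \<subseteq> V <#> F"
  proof
    fix x assume "x \<in> V <#> V"
    then obtain f u where "f \<in> F" "u \<in> U" "x = f \<otimes> u" using \<F> F by blast
    moreover have "u \<in> V" using \<open>u \<in> U\<close> UL V_def by blast
    ultimately have "x = u \<otimes> f" using m_comm Fc Vc by blast
    then show "x \<in> V <#> F" using \<open>u \<in> V\<close> \<open>f \<in> F\<close> unfolding set_mult_def by blast
  qed
  then show thesis using that[of V F] V F Fc UL unfolding V_def by blast
qed

end

lemma abelian_topological_group_product:
  assumes "\<And>i. i \<in> I \<Longrightarrow> abelian_topological_group (G i) (T i)"
  shows "abelian_topological_group (product_group I G) (product_topology T I)"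
proof -
  have A: "abelian_top_group (G i) (T i)" if "i \<in> I" for i
    using assms[OF that] abelian_top_group_iff by blast
  have grp: "group (product_group I G)"
    using A by (intro product_group) (auto simp: abelian_top_group_def comm_group_def)
  have eq: "topspace (T i) = carrier (G i)" if "i \<in> I" for i
    using A[OF that] by (rule abelian_top_group.topspace_eq)
  have comm: "comm_group (product_group I G)"
  proof (rule group.group_comm_groupI[OF grp])
    fix x y assume "x \<in> carrier (product_group I G)" "y \<in> carrier (product_group I G)"
    then show "x \<otimes>\<^bsub>product_group I G\<^esub> y = y \<otimes>\<^bsub>product_group I G\<^esub> x"
      using A by (auto intro!: restrict_ext comm_groupE(4) simp: PiE_iff abelian_top_group_def)
  qed
  have top: "topspace (product_topology T I) = carrier (product_group I G)"
    by (auto simp: eq intro!: PiE_cong)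
  have m: "continuous_map (prod_topology (product_topology T I) (product_topology T I)) (T i)
      (\<lambda>p. fst p i \<otimes>\<^bsub>G i\<^esub> snd p i)" if i: "i \<in> I" for i
  proof (rule abelian_top_group.continuous_map_mult[OF A[OF i]])
    show "continuous_map (prod_topology (product_topology T I) (product_topology T I)) (T i) (\<lambda>p. fst p i)"
      using continuous_map_compose[OF continuous_map_fst continuous_map_product_projection[OF i]]
      by (simp add: o_def)
    show "continuous_map (prod_topology (product_topology T I) (product_topology T I)) (T i) (\<lambda>p. snd p i)"
      using continuous_map_compose[OF continuous_map_snd continuous_map_product_projection[OF i]]
      by (simp add: o_def)
  qed
  have n: "continuous_map (product_topology T I) (T i) (\<lambda>x. inv\<^bsub>G i\<^esub> (x i))" if i: "i \<in> I" for i
    by (rule abelian_top_group.continuous_map_inv[OF A[OF i]])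
       (rule continuous_map_product_projection[OF i])
  have "continuous_map (product_topology T I) (product_topology T I) (\<lambda>x. \<lambda>i\<in>I. inv\<^bsub>G i\<^esub> (x i))"
    using n by (simp add: continuous_map_componentwise image_subset_iff)
  \<comment> \<open>\<open>inv_product_group\<close> computes inverses only for points of the
    carrier, so continuity is transferred along equality on the topological space.\<close>
  then have "continuous_map (product_topology T I) (product_topology T I) (\<lambda>x. inv\<^bsub>product_group I G\<^esub> x)"
  proof (rule continuous_map_eq)
    fix x assume "x \<in> topspace (product_topology T I)"
    then have "x \<in> (\<Pi>\<^sub>E i\<in>I. carrier (G i))" by (simp only: top carrier_product_group)
    then show "(\<lambda>i\<in>I. inv\<^bsub>G i\<^esub> (x i)) = inv\<^bsub>product_group I G\<^esub> x"
      using A by (intro inv_product_group[symmetric]) (auto simp: abelian_top_group_def comm_group_def)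
  qed
  moreover have "continuous_map (prod_topology (product_topology T I) (product_topology T I))
      (product_topology T I) (\<lambda>(x, y). x \<otimes>\<^bsub>product_group I G\<^esub> y)"
    using m by (simp add: continuous_map_componentwise image_subset_iff split_def)
  ultimately show ?thesis
    unfolding abelian_topological_group_def using comm top by blast
qed


section \<open>Quasi-invariant discrete measures on one group\<close>

text \<open>The pointwise inequality is summed over \<open>A\<close>; injectivity ensures that no
  mass of \<open>q\<close> is counted twice.\<close>

lemma pmf_shift_measure_ge:
  assumes "inj_on f A" "0 \<le> c" "\<And>x. x \<in> A \<Longrightarrow> c * pmf p x \<le> pmf q (f x)"
  shows "c * measure_pmf.prob p A \<le> measure_pmf.prob q (f ` A)"
proof -
  have "ennreal (c * measure_pmf.prob p A) = ennreal c * emeasure (measure_pmf p) A"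
    using assms(2) by (simp add: measure_pmf.emeasure_eq_measure ennreal_mult)
  also have "\<dots> = (\<integral>\<^sup>+x. ennreal c * ennreal (pmf p x) \<partial>count_space A)"
    by (simp add: nn_integral_cmult nn_integral_pmf)
  also have "\<dots> \<le> (\<integral>\<^sup>+x. ennreal (pmf q (f x)) \<partial>count_space A)"
    using assms by (intro nn_integral_mono) (auto simp: ennreal_mult[symmetric] intro!: ennreal_leI)
  also have "\<dots> = emeasure (measure_pmf q) (f ` A)"
    by (rule nn_integral_pmf') fact
  finally show ?thesis by (simp add: measure_pmf.emeasure_eq_measure)
qed

lemma summable_power_times_geometric:
  fixes \<rho> :: real
  assumes "0 < \<rho>" "\<rho> < 1"
  shows "summable (\<lambda>j. real (Suc j) ^ d * \<rho> ^ j)"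
proof -
  have "(\<lambda>j. (real (Suc (Suc j)) / real (Suc j)) ^ d * \<rho>) \<longlonglongrightarrow> 1 ^ d * \<rho>"
    by (intro tendsto_intros) (real_asymp)
  then have "eventually (\<lambda>j. (real (Suc (Suc j)) / real (Suc j)) ^ d * \<rho> < (1 + \<rho>) / 2) sequentially"
    using assms by (intro order_tendstoD) auto
  then obtain N where N: "\<And>j. j \<ge> N \<Longrightarrow> (real (Suc (Suc j)) / real (Suc j)) ^ d * \<rho> < (1 + \<rho>) / 2"
    by (auto simp: eventually_sequentially)
  show ?thesis
  proof (rule summable_ratio_test)
    show "(1 + \<rho>) / 2 < 1" using assms by simp
    fix j assume "N \<le> j"
    have "real (Suc (Suc j)) ^ d * \<rho> ^ Suc j
        = (real (Suc (Suc j)) / real (Suc j)) ^ d * \<rho> * (real (Suc j) ^ d * \<rho> ^ j)"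
      by (simp add: power_divide)
    also have "\<dots> \<le> (1 + \<rho>) / 2 * (real (Suc j) ^ d * \<rho> ^ j)"
      using N[OF \<open>N \<le> j\<close>] assms by (intro mult_right_mono) auto
    finally show "norm (real (Suc (Suc j)) ^ d * \<rho> ^ Suc j) \<le> (1 + \<rho>) / 2 * norm (real (Suc j) ^ d * \<rho> ^ j)"
      using assms by simp
  qed
qed

context comm_group
begin

section \<open>Quasi-invariance under finitely many group elements\<close>

definition quasi_inv :: "real \<Rightarrow> 'a pmf \<Rightarrow> 'a \<Rightarrow> bool" where
  "quasi_inv c p g \<longleftrightarrow> (\<forall>x\<in>carrier G. c * pmf p x \<le> pmf p (g \<otimes> x))"

lemma quasi_inv_mult:
  assumes "quasi_inv c p g" "quasi_inv c' p h" "g \<in> carrier G" "h \<in> carrier G" "0 \<le> c"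
  shows "quasi_inv (c * c') p (g \<otimes> h)"
  unfolding quasi_inv_def
proof
  fix x assume x: "x \<in> carrier G"
  have "c * c' * pmf p x \<le> c * pmf p (h \<otimes> x)"
    using assms x unfolding quasi_inv_def by (simp add: mult.assoc mult_left_mono)
  also have "\<dots> \<le> pmf p (g \<otimes> (h \<otimes> x))"
    using assms x unfolding quasi_inv_def by simp
  finally show "c * c' * pmf p x \<le> pmf p (g \<otimes> h \<otimes> x)"
    using assms x by (simp add: m_assoc)
qed

lemma quasi_inv_mono: "quasi_inv c p g \<Longrightarrow> c' \<le> c \<Longrightarrow> quasi_inv c' p g"
  unfolding quasi_inv_def by (meson mult_right_mono pmf_nonneg order_trans)

lemma quasi_inv_one: "quasi_inv 1 p \<one>"
  unfolding quasi_inv_def by simp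

lemma quasi_inv_pow:
  assumes "quasi_inv c p g" "g \<in> carrier G" "0 \<le> c"
  shows "quasi_inv (c ^ n) p (g [^] (n::nat))"
proof (induction n)
  case 0
  then show ?case by (simp add: quasi_inv_one)
next
  case (Suc n)
  then show ?case
    using quasi_inv_mult[OF Suc assms(1)] assms by (simp add: mult.commute)
qed

lemma quasi_inv_measure:
  assumes "quasi_inv c p g" "g \<in> carrier G" "0 \<le> c" "A \<subseteq> carrier G"
  shows "c * measure_pmf.prob p A \<le> measure_pmf.prob p ((\<lambda>x. g \<otimes> x) ` A)"
  using assms unfolding quasi_inv_def
  by (intro pmf_shift_measure_ge) (auto simp: inj_on_def subset_iff)

text \<open>\<open>q\<close> is the law of \<open>g [^] n \<otimes> x\<close> with \<open>x\<close>
  drawn from \<open>p\<close> and \<open>n\<close> geometric with ratio \<open>s\<close>. Then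
  \<open>q\<close> is \<open>1 - s\<close> times \<open>p\<close> plus \<open>s\<close> times the
  \<open>g\<close>-translate of \<open>q\<close>, which gives the bound for \<open>g\<close>; bounds
  for other elements survive the averaging because the group is commutative.\<close>

lemma ex_quasi_inv_insert:
  assumes p: "set_pmf p \<subseteq> carrier G" "0 < pmf p \<one>" and g: "g \<in> carrier G" and s: "0 < s" "s < 1"
  obtains q where "set_pmf q \<subseteq> carrier G" "0 < pmf q \<one>" "quasi_inv s q g"
    "\<And>h. h \<in> carrier G \<Longrightarrow> quasi_inv s p h \<Longrightarrow> quasi_inv s q h"
proof
  let ?N = "geometric_pmf (1 - s)"
  define q where "q = bind_pmf ?N (\<lambda>n. map_pmf (\<lambda>x. g [^] n \<otimes> x) p)"
  show q_sub: "set_pmf q \<subseteq> carrier G"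
    using p g by (auto simp: q_def)
  \<comment> \<open>Off the carrier the equation \<open>a \<otimes> x = y\<close> may have stray
    solutions, so the two events are compared almost everywhere only.\<close>
  have shift: "pmf (map_pmf (\<lambda>x. a \<otimes> x) r) y = pmf r (inv a \<otimes> y)"
    if "a \<in> carrier G" "y \<in> carrier G" "set_pmf r \<subseteq> carrier G" for a y r
  proof -
    have "pmf (map_pmf (\<lambda>x. a \<otimes> x) r) y = measure_pmf.prob r ((\<lambda>x. a \<otimes> x) -` {y})"
      by (rule pmf_map)
    also have "\<dots> = measure_pmf.prob r {inv a \<otimes> y}"
    proof (rule measure_pmf.finite_measure_eq_AE)
      show "AE x in measure_pmf r. (x \<in> (\<lambda>x. a \<otimes> x) -` {y}) = (x \<in> {inv a \<otimes> y})"
        using that by (auto simp: AE_measure_pmf_iff m_assoc[symmetric] subset_iff)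
    qed auto
    finally show ?thesis by (simp add: measure_pmf_single)
  qed
  have int: "pmf q y = (\<integral>n. pmf p (inv (g [^] n) \<otimes> y) \<partial>measure_pmf ?N)" if "y \<in> carrier G" for y
    unfolding q_def pmf_bind using that p g by (simp add: shift)
  \<comment> \<open>A geometric variable is zero with probability \<open>1 - s\<close> and otherwise
    the successor of another geometric variable.\<close>
  have unfold: "q = bind_pmf (bernoulli_pmf (1 - s)) (\<lambda>b. if b then p else map_pmf (\<lambda>x. g \<otimes> x) q)"
  proof -
    have "q = bind_pmf (bernoulli_pmf (1 - s)) (\<lambda>b.
        bind_pmf (if b then return_pmf 0 else map_pmf Suc ?N) (\<lambda>n. map_pmf (\<lambda>x. g [^] n \<otimes> x) p))"
      unfolding q_def using s by (subst geometric_bind_pmf_unfold) (auto simp: bind_assoc_pmf)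
    also have "\<dots> = bind_pmf (bernoulli_pmf (1 - s)) (\<lambda>b. if b then p else map_pmf (\<lambda>x. g \<otimes> x) q)"
    proof (intro bind_pmf_cong refl)
      fix b
      have "map_pmf (\<lambda>x. \<one> \<otimes> x) p = map_pmf (\<lambda>x. x) p"
        using p by (intro map_pmf_cong) auto
      moreover have "map_pmf (\<lambda>x. g [^] Suc n \<otimes> x) p = map_pmf (\<lambda>x. g \<otimes> (g [^] n \<otimes> x)) p" for n
        using p g by (intro map_pmf_cong) (auto simp: m_ac subset_iff)
      ultimately show "bind_pmf (if b then return_pmf 0 else map_pmf Suc ?N) (\<lambda>n. map_pmf (\<lambda>x. g [^] n \<otimes> x) p)
          = (if b then p else map_pmf (\<lambda>x. g \<otimes> x) q)"
        by (simp add: q_def bind_return_pmf map_bind_pmf bind_map_pmf pmf.map_comp o_def del: nat_pow_Suc)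
    qed
    finally show ?thesis .
  qed
  have rec: "pmf q y = (1 - s) * pmf p y + s * pmf (map_pmf (\<lambda>x. g \<otimes> x) q) y" for y
    using s by (subst unfold) (simp add: pmf_bind)
  show "0 < pmf q \<one>"
    unfolding rec using s p by (intro add_pos_nonneg mult_pos_pos) auto
  show "quasi_inv s q g"
    unfolding quasi_inv_def
  proof
    fix x assume x: "x \<in> carrier G"
    have "pmf (map_pmf (\<lambda>x. g \<otimes> x) q) (g \<otimes> x) = pmf q x"
      using x g q_sub by (simp add: shift m_assoc[symmetric])
    then show "s * pmf q x \<le> pmf q (g \<otimes> x)"
      using s by (subst rec) simp
  qed
  show "quasi_inv s q h" if h: "h \<in> carrier G" "quasi_inv s p h" for h
    unfolding quasi_inv_def
  proof
    fix x assume x: "x \<in> carrier G"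
    have bd: "integrable (measure_pmf ?N) (\<lambda>n. pmf p (f n))" for f :: "nat \<Rightarrow> 'a"
      by (rule measure_pmf.integrable_const_bound[where B=1]) (auto simp: pmf_le_1)
    have "s * pmf q x = (\<integral>n. s * pmf p (inv (g [^] n) \<otimes> x) \<partial>measure_pmf ?N)"
      using x by (simp add: int)
    also have "\<dots> \<le> (\<integral>n. pmf p (inv (g [^] n) \<otimes> (h \<otimes> x)) \<partial>measure_pmf ?N)"
    proof (intro integral_mono integrable_mult_right bd)
      fix n :: nat
      have "inv (g [^] n) \<otimes> (h \<otimes> x) = h \<otimes> (inv (g [^] n) \<otimes> x)"
        using g h x by (simp add: m_lcomm)
      then show "s * pmf p (inv (g [^] n) \<otimes> x) \<le> pmf p (inv (g [^] n) \<otimes> (h \<otimes> x))"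
        using h g x unfolding quasi_inv_def by simp
    qed
    also have "\<dots> = pmf q (h \<otimes> x)"
      using x h by (simp add: int)
    finally show "s * pmf q x \<le> pmf q (h \<otimes> x)" .
  qed
qed

text \<open>Start from the point mass at the identity and insert one element at a time. The constant
  \<open>s\<close> does not deteriorate with the number of elements.\<close>

lemma ex_quasi_inv_finite:
  assumes "finite D" "D \<subseteq> carrier G" "0 < s" "s < 1"
  shows "\<exists>q. set_pmf q \<subseteq> carrier G \<and> 0 < pmf q \<one> \<and> (\<forall>g\<in>D. quasi_inv s q g)"
  using assms
proof (induction D)
  case empty
  show ?case by (rule exI[of _ "return_pmf \<one>"]) auto
next
  case (insert g D)
  then obtain p where p: "set_pmf p \<subseteq> carrier G" "0 < pmf p \<one>" "\<forall>g\<in>D. quasi_inv s p g"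
    by auto
  have "g \<in> carrier G" using insert by auto
  from ex_quasi_inv_insert[OF p(1,2) this \<open>0 < s\<close> \<open>s < 1\<close>] obtain q
    where "set_pmf q \<subseteq> carrier G" "0 < pmf q \<one>" "quasi_inv s q g"
    "\<And>h. h \<in> carrier G \<Longrightarrow> quasi_inv s p h \<Longrightarrow> quasi_inv s q h" by metis
  then show ?case using p insert by (intro exI[of _ q]) auto
qed

section \<open>Polynomial growth of the powers of a set\<close>

primrec ball_pow :: "'a set \<Rightarrow> nat \<Rightarrow> 'a set" where
  "ball_pow V 0 = V"
| "ball_pow V (Suc n) = ball_pow V n <#> V"

text \<open>The products of powers of the listed generators, all exponents at most \<open>n\<close>.
  By commutativity such boxes capture all words of length \<open>n\<close>, yet they have only
  polynomially many elements.\<close>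

primrec word_box :: "'a list \<Rightarrow> nat \<Rightarrow> 'a set" where
  "word_box [] n = {\<one>}"
| "word_box (f # fs) n = (\<lambda>(a, x). f [^] a \<otimes> x) ` ({..n} \<times> word_box fs n)"

lemma finite_word_box: "finite (word_box fs n)"
  by (induction fs) auto

lemma card_word_box: "card (word_box fs n) \<le> Suc n ^ length fs"
proof (induction fs)
  case (Cons f fs)
  have "card (word_box (f # fs) n) \<le> card ({..n} \<times> word_box fs n)"
    unfolding word_box.simps by (intro card_image_le finite_cartesian_product finite_word_box) simp
  also have "\<dots> \<le> Suc n * Suc n ^ length fs"
    unfolding card_cartesian_product using Cons by (intro mult_mono) auto
  finally show ?case by simp
qed simp

lemma word_box_carrier: "set fs \<subseteq> carrier G \<Longrightarrow> word_box fs n \<subseteq> carrier G"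
  by (induction fs) auto

lemma one_in_word_box: "\<one> \<in> word_box fs n"
  by (induction fs) (auto intro!: image_eqI[of _ _ "(0, \<one>)"])

lemma word_box_mono: "n \<le> m \<Longrightarrow> word_box fs n \<subseteq> word_box fs m"
proof (induction fs)
  case (Cons f fs)
  then have "{..n} \<times> word_box fs n \<subseteq> {..m} \<times> word_box fs m" by auto
  then show ?case by (simp add: image_mono)
qed simp

text \<open>Commutativity lets \<open>f\<close> travel to its own position in the list, where it
  raises one exponent by one.\<close>

lemma word_box_mult:
  assumes "f \<in> set fs" "x \<in> word_box fs n" "set fs \<subseteq> carrier G"
  shows "f \<otimes> x \<in> word_box fs (Suc n)"
  using assms
proof (induction fs arbitrary: x)
  case (Cons h fs)
  obtain a y where ay: "a \<le> n" "y \<in> word_box fs n" "x = h [^] a \<otimes> y" using Cons.prems by auto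
  have y: "y \<in> carrier G" using ay word_box_carrier[of fs n] Cons.prems by auto
  show ?case
  proof (cases "f = h")
    case True
    then have "f \<otimes> x = h [^] Suc a \<otimes> y"
      using ay y Cons.prems True by (simp add: m_ac)
    moreover have "y \<in> word_box fs (Suc n)" using ay word_box_mono[of n "Suc n"] by auto
    ultimately show ?thesis using ay by (auto intro!: image_eqI[of _ _ "(Suc a, y)"] simp del: nat_pow_Suc)
  next
    case False
    then have "f \<otimes> y \<in> word_box fs (Suc n)" using Cons ay by auto
    moreover have "f \<in> carrier G" using Cons.prems by blast
    then have "f \<otimes> x = h [^] a \<otimes> (f \<otimes> y)"
      using ay(3) y Cons.prems(3) by (simp add: m_ac)
    ultimately show ?thesis using ay by (auto intro!: image_eqI[of _ _ "(a, f \<otimes> y)"])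
  qed
qed simp

lemma ball_pow_carrier: "V \<subseteq> carrier G \<Longrightarrow> ball_pow V n \<subseteq> carrier G"
  by (induction n) (auto simp: set_mult_def subset_iff)

text \<open>\<open>ball_pow V n\<close> has \<open>n + 1\<close> factors from \<open>V\<close>. The
  doubling property trades two of them for one factor from \<open>V\<close> and one generator, so
  \<open>n\<close> exchanges leave one factor and a word of length \<open>n\<close>.\<close>

lemma ball_pow_subset_word_box:
  assumes V: "V \<subseteq> carrier G" and fs: "set fs \<subseteq> carrier G" "V <#> V \<subseteq> V <#> set fs"
  shows "ball_pow V n \<subseteq> V <#> word_box fs n"
proof (induction n)
  case 0
  show ?case
  proof
    fix x assume "x \<in> ball_pow V 0"
    then have "x \<in> V" "x = x \<otimes> \<one>" using V by auto
    then show "x \<in> V <#> word_box fs 0" unfolding set_mult_def using one_in_word_box by blast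
  qed
next
  case (Suc n)
  show ?case
  proof
    fix x assume "x \<in> ball_pow V (Suc n)"
    then obtain y v where yv: "y \<in> ball_pow V n" "v \<in> V" "x = y \<otimes> v" by (auto simp: set_mult_def)
    then obtain u b where ub: "u \<in> V" "b \<in> word_box fs n" "y = u \<otimes> b"
      using Suc by (force simp: set_mult_def)
    have "u \<otimes> v \<in> V <#> V" using ub yv unfolding set_mult_def by blast
    then obtain w f where wf: "w \<in> V" "f \<in> set fs" "u \<otimes> v = w \<otimes> f"
      using fs(2) by (force simp: set_mult_def)
    have c: "u \<in> carrier G" "v \<in> carrier G" "w \<in> carrier G" "f \<in> carrier G" "b \<in> carrier G"
      using ub yv wf V fs word_box_carrier[of fs n] by auto
    have "x = (u \<otimes> v) \<otimes> b" using yv ub c by (simp add: m_ac)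
    also have "\<dots> = w \<otimes> (f \<otimes> b)" using wf c by (simp add: m_assoc)
    finally show "x \<in> V <#> word_box fs (Suc n)"
      unfolding set_mult_def using wf word_box_mult[OF wf(2) ub(2) fs(1)] by blast
  qed
qed

text \<open>Each of the \<open>length fs\<close> generators occurs at most \<open>n\<close> times,
  and each occurrence costs a factor of at least \<open>s\<close>.\<close>

lemma quasi_inv_word_box:
  assumes "\<And>f. f \<in> set fs \<Longrightarrow> quasi_inv s q (inv f)" "set fs \<subseteq> carrier G" "0 < s" "s \<le> 1"
    "b \<in> word_box fs n"
  shows "quasi_inv ((s ^ length fs) ^ n) q (inv b)"
  using assms
proof (induction fs arbitrary: b)
  case Nil
  then show ?case by (simp add: quasi_inv_one)
next
  case (Cons f fs)
  obtain a x where ax: "a \<le> n" "x \<in> word_box fs n" "b = f [^] a \<otimes> x" using Cons.prems by auto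
  have x: "x \<in> carrier G" using ax word_box_carrier[of fs n] Cons.prems by auto
  have f: "f \<in> carrier G" using Cons.prems by auto
  have "quasi_inv (s ^ a) q (inv f [^] a)"
    using Cons.prems f by (intro quasi_inv_pow) auto
  then have "quasi_inv (s ^ n) q (inv f [^] a)"
    by (rule quasi_inv_mono) (use Cons.prems ax in \<open>auto intro!: power_decreasing\<close>)
  moreover have "quasi_inv ((s ^ length fs) ^ n) q (inv x)"
    using Cons ax by auto
  ultimately have "quasi_inv (s ^ n * (s ^ length fs) ^ n) q (inv f [^] a \<otimes> inv x)"
    using f x Cons.prems by (intro quasi_inv_mult) auto
  then show ?case
    using f x ax by (simp add: inv_mult nat_pow_inv power_mult_distrib)
qed

text \<open>The power is covered by polynomially many translates \<open>b V\<close>, and moving one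
  of them back onto \<open>V\<close> costs \<open>(s ^ length fs) ^ n\<close>. Apart from the mass
  of \<open>V\<close>, the bound does not depend on \<open>q\<close>.\<close>

lemma measure_ball_pow_le:
  assumes V: "V \<subseteq> carrier G" and fs: "set fs \<subseteq> carrier G" "V <#> V \<subseteq> V <#> set fs"
    and q: "\<And>f. f \<in> set fs \<Longrightarrow> quasi_inv s q (inv f)" and s: "0 < s" "s \<le> 1"
  shows "(s ^ length fs) ^ n * measure_pmf.prob q (ball_pow V n)
    \<le> real (Suc n) ^ length fs * measure_pmf.prob q V"
proof -
  let ?c = "(s ^ length fs) ^ n" and ?B = "word_box fs n"
  have B: "?B \<subseteq> carrier G" by (rule word_box_carrier) (rule fs)
  have "ball_pow V n \<subseteq> (\<Union>b\<in>?B. (\<lambda>v. b \<otimes> v) ` V)"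
  proof
    fix x assume "x \<in> ball_pow V n"
    then obtain v b where vb: "v \<in> V" "b \<in> ?B" "x = v \<otimes> b"
      using ball_pow_subset_word_box[OF V fs, of n] by (force simp: set_mult_def)
    then have "x = b \<otimes> v" using B V m_comm by blast
    then show "x \<in> (\<Union>b\<in>?B. (\<lambda>v. b \<otimes> v) ` V)" using vb by blast
  qed
  then have "measure_pmf.prob q (ball_pow V n) \<le> measure_pmf.prob q (\<Union>b\<in>?B. (\<lambda>v. b \<otimes> v) ` V)"
    by (intro measure_pmf.finite_measure_mono) auto
  also have "\<dots> \<le> (\<Sum>b\<in>?B. measure_pmf.prob q ((\<lambda>v. b \<otimes> v) ` V))"
    by (intro measure_pmf.finite_measure_subadditive_finite finite_word_box) auto
  finally have "?c * measure_pmf.prob q (ball_pow V n) \<le> ?c * (\<Sum>b\<in>?B. measure_pmf.prob q ((\<lambda>v. b \<otimes> v) ` V))"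
    using s by (intro mult_left_mono) auto
  also have "\<dots> = (\<Sum>b\<in>?B. ?c * measure_pmf.prob q ((\<lambda>v. b \<otimes> v) ` V))"
    by (rule sum_distrib_left)
  also have "\<dots> \<le> (\<Sum>b\<in>?B. measure_pmf.prob q V)"
  proof (rule sum_mono)
    fix b assume b: "b \<in> ?B"
    have bc: "b \<in> carrier G" using b B by auto
    have "?c * measure_pmf.prob q ((\<lambda>v. b \<otimes> v) ` V) \<le> measure_pmf.prob q ((\<lambda>x. inv b \<otimes> x) ` (\<lambda>v. b \<otimes> v) ` V)"
      using q fs s b bc V by (intro quasi_inv_measure quasi_inv_word_box) auto
    also have "(\<lambda>x. inv b \<otimes> x) ` (\<lambda>v. b \<otimes> v) ` V = (\<lambda>v. v) ` V"
      unfolding image_image using V bc by (intro image_cong) (auto simp: m_assoc[symmetric] subset_iff)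
    finally show "?c * measure_pmf.prob q ((\<lambda>v. b \<otimes> v) ` V) \<le> measure_pmf.prob q V" by simp
  qed
  also have "\<dots> = real (card ?B) * measure_pmf.prob q V" by simp
  also have "\<dots> \<le> real (Suc n) ^ length fs * measure_pmf.prob q V"
  proof (rule mult_right_mono)
    show "real (card ?B) \<le> real (Suc n) ^ length fs"
      using card_word_box[of fs n] by (metis of_nat_le_iff of_nat_power)
  qed simp
  finally show ?thesis .
qed


section \<open>Damping by word length\<close>

definition ball_weight :: "'a set \<Rightarrow> real \<Rightarrow> 'a \<Rightarrow> real" where
  "ball_weight V r x = (if \<exists>n. x \<in> ball_pow V n then r ^ (LEAST n. x \<in> ball_pow V n) else 0)"

lemma ball_weight_bounds: "0 \<le> r \<Longrightarrow> r \<le> 1 \<Longrightarrow> 0 \<le> ball_weight V r x \<and> ball_weight V r x \<le> 1"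
  by (auto simp: ball_weight_def power_le_one)

text \<open>Powers are numbered so that \<open>V\<close> itself has index 0; hence points of
  \<open>V\<close> are not damped, and the weighted total mass is at least the mass of
  \<open>V\<close>.\<close>

lemma ball_weight_core: "x \<in> V \<Longrightarrow> ball_weight V r x = 1"
proof -
  assume x: "x \<in> V"
  then have "(LEAST n. x \<in> ball_pow V n) = 0" by (intro Least_equality) auto
  moreover have "\<exists>n. x \<in> ball_pow V n" using x by (intro exI[of _ 0]) simp
  ultimately show ?thesis by (simp add: ball_weight_def)
qed

text \<open>Multiplication by an element of \<open>V\<close> raises the word length by at most
  one.\<close>

lemma ball_weight_mult:
  assumes "z \<in> V" "x \<in> carrier G" "V \<subseteq> carrier G" "0 \<le> r" "r \<le> 1"
  shows "r * ball_weight V r x \<le> ball_weight V r (z \<otimes> x)"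
proof (cases "\<exists>n. x \<in> ball_pow V n")
  case True
  let ?n = "LEAST n. x \<in> ball_pow V n"
  have "x \<in> ball_pow V ?n" using True by (rule LeastI_ex)
  moreover have "z \<otimes> x = x \<otimes> z" using assms m_comm by blast
  ultimately have "z \<otimes> x \<in> ball_pow V (Suc ?n)" using assms(1) by (auto simp: set_mult_def)
  then have "\<exists>n. z \<otimes> x \<in> ball_pow V n" "(LEAST n. z \<otimes> x \<in> ball_pow V n) \<le> Suc ?n"
    by (blast, rule Least_le)
  then show ?thesis
    using assms True power_decreasing[of _ "Suc ?n" r] by (simp add: ball_weight_def)
next
  case False
  then show ?thesis using assms ball_weight_bounds by (simp add: ball_weight_def[of V r x])
qed

lemma ball_pow_mono: "\<one> \<in> V \<Longrightarrow> V \<subseteq> carrier G \<Longrightarrow> n \<le> m \<Longrightarrow> ball_pow V n \<subseteq> ball_pow V m"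
proof (rule lift_Suc_mono_le[of "ball_pow V"])
  fix n assume V: "\<one> \<in> V" "V \<subseteq> carrier G"
  show "ball_pow V n \<subseteq> ball_pow V (Suc n)"
  proof
    fix x assume x: "x \<in> ball_pow V n"
    then have "x = x \<otimes> \<one>" using subsetD[OF ball_pow_carrier[OF V(2)] x] by simp
    then show "x \<in> ball_pow V (Suc n)" using x V unfolding ball_pow.simps set_mult_def by blast
  qed
qed

text \<open>The powers increase, so the first index at which \<open>x\<close> appears is at least
  \<open>N\<close>; the term of the series at this index already equals the weight.\<close>

lemma ball_weight_outside:
  assumes "x \<notin> ball_pow V N" "0 \<le> r" "\<one> \<in> V" "V \<subseteq> carrier G"
  shows "ennreal (ball_weight V r x) \<le> (\<Sum>j. ennreal (r ^ (j + N)) * indicator (ball_pow V (j + N)) x)"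
proof (cases "\<exists>n. x \<in> ball_pow V n")
  case True
  let ?n = "LEAST n. x \<in> ball_pow V n"
  have n: "x \<in> ball_pow V ?n" using True by (rule LeastI_ex)
  have "N \<le> ?n"
    using n assms ball_pow_mono[of V ?n N] by (meson nle_le subsetD)
  then have "ennreal (ball_weight V r x) = ennreal (r ^ ((?n - N) + N)) * indicator (ball_pow V ((?n - N) + N)) x"
    using n True by (simp add: ball_weight_def)
  also have "\<dots> = (\<Sum>j\<in>{?n - N}. ennreal (r ^ (j + N)) * indicator (ball_pow V (j + N)) x)"
    by (subst sum.insert) (simp_all only: finite.emptyI empty_iff not_False_eq_True sum.empty add_0_right)
  also have "\<dots> \<le> (\<Sum>j. ennreal (r ^ (j + N)) * indicator (ball_pow V (j + N)) x)"
    by (rule sum_le_suminf) auto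
  finally show ?thesis .
qed (simp add: ball_weight_def)

text \<open>The point is that \<open>N\<close> is chosen before \<open>Z\<close>.\<close>

lemma ex_quasi_inv_concentrated:
  assumes V: "V \<subseteq> carrier G" "\<one> \<in> V" and F: "finite F" "F \<subseteq> carrier G" "V <#> V \<subseteq> V <#> F"
    and c: "0 < c" "c < 1"
  shows "\<exists>N. \<forall>Z. finite Z \<and> Z \<subseteq> V \<longrightarrow> (\<exists>p. set_pmf p \<subseteq> carrier G \<and>
    c \<le> measure_pmf.prob p (ball_pow V N) \<and> (\<forall>z\<in>Z. quasi_inv c p z))"
proof -
  obtain fs where fs: "set fs = F" using F(1) finite_list by blast
  define d where "d = length fs"
  \<comment> \<open>Three factors \<rho> are spent: two on the weight, whose base is the square of
    \<rho>, and one on the quasi-invariance of \<open>q\<close>.\<close>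
  define \<rho> where "\<rho> = root 3 c"
  have \<rho>: "0 < \<rho>" "\<rho> < 1" "\<rho> ^ 3 = c" using c unfolding \<rho>_def by (auto simp: real_root_lt_1_iff)
  \<comment> \<open>With \<open>s ^ Suc d = \<rho>\<close>, both \<open>s\<close> and
    \<open>s ^ d\<close> are at least \<rho>: the first serves for a single translation, the second
    for a word box.\<close>
  define s where "s = root (Suc d) \<rho>"
  have s: "0 < s" "s < 1" "s ^ Suc d = \<rho>" using \<rho> unfolding s_def by (auto simp: real_root_lt_1_iff simp del: power_Suc)
  have s\<rho>: "\<rho> \<le> s" "\<rho> \<le> s ^ d"
    using s power_decreasing[of 1 "Suc d" s] power_decreasing[of d "Suc d" s] by (auto simp del: power_Suc)
  define a where "a j = real (Suc j) ^ d * \<rho> ^ j" for j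
  have a: "summable a" unfolding a_def using \<rho> by (intro summable_power_times_geometric)
  \<comment> \<open>The series \<open>a\<close> depends only on \<open>c\<close> and on the number
    \<open>d\<close> of generators. Its tail bounds the relative mass outside
    \<open>ball_pow V N\<close> for every \<open>q\<close> constructed below.\<close>
  have "(\<lambda>N. \<Sum>j. a (j + N)) \<longlonglongrightarrow> 0" by (rule suminf_exist_split2[OF a])
  then have "eventually (\<lambda>N. (\<Sum>j. a (j + N)) < 1 - c) sequentially"
    using c by (intro order_tendstoD) auto
  then obtain N where N: "(\<Sum>j. a (j + N)) < 1 - c"
    by (auto simp: eventually_sequentially)
  have "\<exists>p. set_pmf p \<subseteq> carrier G \<and> c \<le> measure_pmf.prob p (ball_pow V N) \<and> (\<forall>z\<in>Z. quasi_inv c p z)"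
    if Z: "finite Z" "Z \<subseteq> V" for Z
  proof -
    \<comment> \<open>The inverses of the generators are included so that
      \<open>measure_ball_pow_le\<close> applies to \<open>q\<close>.\<close>
    have fin: "finite (Z \<union> (\<lambda>f. inv f) ` F)" "Z \<union> (\<lambda>f. inv f) ` F \<subseteq> carrier G" using Z F V by auto
    from ex_quasi_inv_finite[OF fin s(1,2)] obtain q where q: "set_pmf q \<subseteq> carrier G" "0 < pmf q \<one>"
      "\<And>z. z \<in> Z \<Longrightarrow> quasi_inv s q z" "\<And>f. f \<in> F \<Longrightarrow> quasi_inv s q (inv f)" by blast
    \<comment> \<open>One factor of \<open>\<rho>\<^sup>2\<close> absorbs the loss \<open>(s ^ d) ^ j\<close> of measure_ball_pow_le, the other gives summability.\<close>
    define w where "w = ball_weight V (\<rho> ^ 2)"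
    have w: "0 \<le> w x" "w x \<le> 1" for x
      using ball_weight_bounds[of "\<rho> ^ 2" V x] \<rho> by (auto simp: w_def power_le_one)
    have int_w: "integrable (measure_pmf q) w"
      by (rule measure_pmf.integrable_const_bound[where B=1]) (auto simp: w)
    define W where "W = (\<integral>x. w x \<partial>measure_pmf q)"
    \<comment> \<open>The growth estimate is relative to the mass of \<open>V\<close>, so this turns
      it into an estimate relative to the normalising constant \<open>W\<close>.\<close>
    have qV: "measure_pmf.prob q V \<le> W"
    proof -
      have "integrable (measure_pmf q) (indicator V :: 'a \<Rightarrow> real)"
        by (rule measure_pmf.integrable_const_bound[where B=1]) auto
      moreover have "indicator V x \<le> w x" for x
        using w by (auto simp: indicator_def w_def ball_weight_core)
      moreover have "measure_pmf.prob q V = (\<integral>x. indicator V x \<partial>measure_pmf q)" by simp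
      ultimately show ?thesis
        unfolding W_def using integral_mono[OF _ int_w, of "indicator V"] by simp
    qed
    have qpos: "0 < measure_pmf.prob q V"
    proof -
      have "pmf q \<one> = measure_pmf.prob q {\<one>}" by (simp add: measure_pmf_single)
      also have "\<dots> \<le> measure_pmf.prob q V" using V by (intro measure_pmf.finite_measure_mono) auto
      finally show ?thesis using q by simp
    qed
    have Wpos: "0 < W" using qV qpos by linarith
    define f where "f x = w x * pmf q x / W" for x
    have f0: "0 \<le> f x" for x using w Wpos by (simp add: f_def)
    have nn: "(\<integral>\<^sup>+x. ennreal (f x) * indicator A x \<partial>count_space UNIV)
        = (\<integral>\<^sup>+x. ennreal (w x) * indicator A x \<partial>measure_pmf q) / ennreal W" for A
    proof -
      have "(\<integral>\<^sup>+x. ennreal (f x) * indicator A x \<partial>count_space UNIV)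
          = (\<integral>\<^sup>+x. (ennreal (pmf q x) * (ennreal (w x) * indicator A x)) / ennreal W \<partial>count_space UNIV)"
        using w Wpos by (intro nn_integral_cong)
          (auto simp: f_def indicator_def divide_ennreal ennreal_mult[symmetric] mult.commute)
      also have "\<dots> = (\<integral>\<^sup>+x. ennreal (pmf q x) * (ennreal (w x) * indicator A x) \<partial>count_space UNIV) / ennreal W"
        by (rule nn_integral_divide) simp
      finally show ?thesis by (simp add: nn_integral_measure_pmf)
    qed
    have "(\<integral>\<^sup>+x. ennreal (w x) \<partial>measure_pmf q) = ennreal W"
      unfolding W_def using w by (intro nn_integral_eq_integral int_w) auto
    then have f1: "(\<integral>\<^sup>+x. ennreal (f x) \<partial>count_space UNIV) = 1"
      using nn[of UNIV] Wpos by (simp add: divide_ennreal)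
    define p where "p = embed_pmf f"
    have pmf_p: "pmf p x = f x" for x unfolding p_def by (rule pmf_embed_pmf[OF f0 f1])
    have out: "emeasure (measure_pmf p) (- ball_pow V N) \<le> ennreal (1 - c)"
    proof -
      have "emeasure (measure_pmf p) (- ball_pow V N)
          = (\<integral>\<^sup>+x. ennreal (pmf p x) \<partial>count_space (- ball_pow V N))"
        by (rule nn_integral_pmf[symmetric])
      also have "\<dots> = (\<integral>\<^sup>+x. ennreal (f x) * indicator (- ball_pow V N) x \<partial>count_space UNIV)"
        by (simp add: nn_integral_count_space_indicator pmf_p)
      also have "\<dots> = (\<integral>\<^sup>+x. ennreal (w x) * indicator (- ball_pow V N) x \<partial>measure_pmf q) / ennreal W"
        by (rule nn)
      also have "\<dots> \<le> ennreal ((1 - c) * W) / ennreal W"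
      proof (rule divide_right_mono_ennreal)
        have "(\<integral>\<^sup>+x. ennreal (w x) * indicator (- ball_pow V N) x \<partial>measure_pmf q)
            \<le> (\<integral>\<^sup>+x. (\<Sum>j. ennreal ((\<rho>\<^sup>2) ^ (j + N)) * indicator (ball_pow V (j + N)) x) \<partial>measure_pmf q)"
          using V \<rho> by (intro nn_integral_mono) (auto simp: indicator_def w_def intro!: ball_weight_outside[unfolded indicator_def])
        also have "\<dots> = (\<Sum>j. \<integral>\<^sup>+x. ennreal ((\<rho>\<^sup>2) ^ (j + N)) * indicator (ball_pow V (j + N)) x \<partial>measure_pmf q)"
          by (intro nn_integral_suminf) auto
        also have "\<dots> = (\<Sum>j. ennreal ((\<rho>\<^sup>2) ^ (j + N) * measure_pmf.prob q (ball_pow V (j + N))))"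
          using \<rho> by (simp add: nn_integral_cmult_indicator measure_pmf.emeasure_eq_measure ennreal_mult)
        also have "\<dots> \<le> (\<Sum>j. ennreal (a (j + N) * W))"
        proof (intro suminf_le allI ennreal_leI summableI)
          fix j
          have "(\<rho>\<^sup>2) ^ (j + N) * measure_pmf.prob q (ball_pow V (j + N))
              = \<rho> ^ (j + N) * (\<rho> ^ (j + N) * measure_pmf.prob q (ball_pow V (j + N)))"
            by (simp add: power2_eq_square power_mult_distrib)
          also have "\<dots> \<le> \<rho> ^ (j + N) * ((s ^ d) ^ (j + N) * measure_pmf.prob q (ball_pow V (j + N)))"
            using \<rho> s\<rho> by (intro mult_left_mono mult_right_mono power_mono) auto
          also have "\<dots> \<le> \<rho> ^ (j + N) * (real (Suc (j + N)) ^ d * measure_pmf.prob q V)"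
            unfolding d_def using V F fs q s \<rho> by (intro mult_left_mono measure_ball_pow_le) auto
          also have "\<dots> \<le> \<rho> ^ (j + N) * (real (Suc (j + N)) ^ d * W)"
            using \<rho> qV by (intro mult_left_mono) auto
          finally show "(\<rho>\<^sup>2) ^ (j + N) * measure_pmf.prob q (ball_pow V (j + N)) \<le> a (j + N) * W"
            by (simp add: a_def mult_ac)
        qed
        also have "\<dots> = ennreal ((\<Sum>j. a (j + N)) * W)"
        proof -
          have "summable (\<lambda>j. a (j + N))" using a by (simp add: summable_iff_shift)
          then have "(\<lambda>j. a (j + N) * W) sums ((\<Sum>j. a (j + N)) * W)"
            by (intro sums_mult2 summable_sums)
          then show ?thesis
            using Wpos \<rho> by (intro suminf_ennreal_eq) (auto simp: a_def)
        qed
        also have "\<dots> \<le> ennreal ((1 - c) * W)"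
          using N Wpos by (intro ennreal_leI mult_right_mono) auto
        finally show "(\<integral>\<^sup>+x. ennreal (w x) * indicator (- ball_pow V N) x \<partial>measure_pmf q) \<le> ennreal ((1 - c) * W)" .
      qed
      also have "\<dots> = ennreal (1 - c)" using Wpos c by (simp add: divide_ennreal)
      finally show ?thesis .
    qed
    have "measure_pmf.prob p (- ball_pow V N) \<le> 1 - c"
      using out c by (simp add: measure_pmf.emeasure_eq_measure)
    then have "c \<le> measure_pmf.prob p (ball_pow V N)"
      using measure_pmf.prob_compl[of "ball_pow V N" p] by (simp add: Compl_eq_Diff_UNIV)
    moreover have "set_pmf p \<subseteq> carrier G"
      using q by (auto simp: set_pmf_iff pmf_p f_def)
    moreover have "quasi_inv c p z" if z: "z \<in> Z" for z
      unfolding quasi_inv_def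
    proof
      fix x assume x: "x \<in> carrier G"
      \<comment> \<open>The two groups of factors are estimated separately: the weight changes by at
        most the square of \<rho>, the density of \<open>q\<close> by at most \<rho>.\<close>
      have "c * pmf p x = (\<rho>\<^sup>2 * w x) * (\<rho> * pmf q x) / W"
        using \<rho> by (simp add: pmf_p f_def power2_eq_square power3_eq_cube flip: \<rho>(3))
      also have "\<dots> \<le> w (z \<otimes> x) * pmf q (z \<otimes> x) / W"
      proof (intro divide_right_mono mult_mono)
        show "\<rho>\<^sup>2 * w x \<le> w (z \<otimes> x)"
          unfolding w_def using z Z V x \<rho> by (intro ball_weight_mult) (auto simp: power_le_one)
        have "\<rho> * pmf q x \<le> s * pmf q x" using s\<rho> by (simp add: mult_right_mono)
        also have "\<dots> \<le> pmf q (z \<otimes> x)" using q(3)[OF z] x by (simp add: quasi_inv_def)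
        finally show "\<rho> * pmf q x \<le> pmf q (z \<otimes> x)" .
      qed (use w \<rho> Wpos in auto)
      finally show "c * pmf p x \<le> pmf p (z \<otimes> x)" by (simp add: pmf_p f_def)
    qed
    ultimately show ?thesis by blast
  qed
  then show ?thesis by blast
qed

end


section \<open>Quasi-invariant finitely additive measures on products\<close>

text \<open>The condition ranges over all functions, not just points of the product group; the
  carrier is intersected in explicitly where it matters.\<close>

definition cylinder :: "'i set \<Rightarrow> ('i \<Rightarrow> 'a) set \<Rightarrow> bool" where
  "cylinder J S \<longleftrightarrow> (\<forall>x y. (\<forall>k\<in>J. x k = y k) \<longrightarrow> x \<in> S \<longleftrightarrow> y \<in> S)"

lemma cylinder_mono: "cylinder J S \<Longrightarrow> J \<subseteq> J' \<Longrightarrow> cylinder J' S"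
  unfolding cylinder_def by blast

lemma cylinder_Un: "cylinder J S \<Longrightarrow> cylinder J S' \<Longrightarrow> cylinder J (S \<union> S')"
  and cylinder_Int: "cylinder J S \<Longrightarrow> cylinder J S' \<Longrightarrow> cylinder J (S \<inter> S')"
  unfolding cylinder_def by blast+

text \<open>The product of the measures \<open>p k\<close> over \<open>k < n\<close>, with the
  identity in all later coordinates. Translation costs the product of the \<open>c k\<close>.
  Cylinders over the first \<open>n\<close> coordinates do not notice that later coordinates of
  \<open>z\<close> are lost.\<close>

lemma ex_pmf_product_stage:
  fixes G :: "nat \<Rightarrow> ('a, 'm) monoid_scheme"
  assumes G: "\<And>k. comm_group (G k)"
    and p: "\<And>k. set_pmf (p k) \<subseteq> carrier (G k)"
    and L: "\<And>k. \<one>\<^bsub>G k\<^esub> \<in> L k" "\<And>k. c k \<le> measure_pmf.prob (p k) (L k)"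
    and c: "\<And>k. 0 \<le> c k" "b \<le> (\<Prod>k<n. c k)"
    and Z: "Z \<subseteq> carrier (product_group UNIV G)"
      "\<And>z k. z \<in> Z \<Longrightarrow> comm_group.quasi_inv (G k) (c k) (p k) (z k)"
  obtains \<mu> where "b \<le> measure_pmf.prob \<mu> (\<Pi>\<^sub>E k\<in>UNIV. L k)"
    "\<And>z S. \<lbrakk>z \<in> Z; cylinder {..<n} S\<rbrakk> \<Longrightarrow>
      b * measure_pmf.prob \<mu> {x \<in> carrier (product_group UNIV G). z \<otimes>\<^bsub>product_group UNIV G\<^esub> x \<in> S}
        \<le> measure_pmf.prob \<mu> (S \<inter> carrier (product_group UNIV G))"
proof
  let ?P = "product_group UNIV G"
  define R where "R = Pi_pmf {..<n} undefined p"
  \<comment> \<open>\<open>Pi_pmf\<close> fills later coordinates with \<open>undefined\<close>;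
    replacing this by the identity gives points of the group and stays inside the sets
    \<open>L k\<close>.\<close>
  define e where "e f k = (if k < n then f k else \<one>\<^bsub>G k\<^esub>)" for f k
  define \<mu> where "\<mu> = map_pmf e R"
  have one: "\<one>\<^bsub>G k\<^esub> \<in> carrier (G k)" for k
    using G[of k] by (simp add: comm_group_def group_def monoid.one_closed)
  have set_R: "set_pmf R \<subseteq> {f. (\<forall>k<n. f k \<in> carrier (G k)) \<and> (\<forall>k\<ge>n. f k = undefined)}"
    unfolding R_def using p set_Pi_pmf_subset'[of "{..<n}" undefined p]
    by (fastforce simp: PiE_dflt_def subset_iff)
  show "b \<le> measure_pmf.prob \<mu> (\<Pi>\<^sub>E k\<in>UNIV. L k)"
  proof -
    have "b \<le> (\<Prod>k<n. c k)" by (rule c)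
    also have "\<dots> \<le> (\<Prod>k<n. measure_pmf.prob (p k) (L k))"
      using L c by (intro prod_mono) auto
    also have "\<dots> = measure_pmf.prob R (Pi {..<n} L)"
      unfolding R_def by (simp add: measure_Pi_pmf_Pi)
    also have "\<dots> \<le> measure_pmf.prob R (e -` (\<Pi>\<^sub>E k\<in>UNIV. L k))"
      using L by (intro measure_pmf.finite_measure_mono) (auto simp: e_def PiE_iff Pi_iff)
    finally show ?thesis by (simp add: \<mu>_def)
  qed
  fix z and S :: "(nat \<Rightarrow> 'a) set" assume z: "z \<in> Z" and S: "cylinder {..<n} S"
  have zc: "z k \<in> carrier (G k)" for k using z Z by (auto simp: PiE_iff)
  \<comment> \<open>The translation by \<open>z\<close> in terms of \<open>R\<close>: it acts on the
    first \<open>n\<close> coordinates and keeps the default value elsewhere.\<close>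
  define \<tau> where "\<tau> f k = (if k < n then z k \<otimes>\<^bsub>G k\<^esub> f k else undefined)" for f k
  \<comment> \<open>Restriction to the support of \<open>R\<close> makes the later coordinates
    constant, which is needed for \<tau> to be injective.\<close>
  define A where "A = set_pmf R \<inter> {f. z \<otimes>\<^bsub>?P\<^esub> e f \<in> S}"
  have A_sub: "A \<subseteq> {f. (\<forall>k<n. f k \<in> carrier (G k)) \<and> (\<forall>k\<ge>n. f k = undefined)}"
    unfolding A_def by (rule le_infI1) (rule set_R)
  have A_carrier: "f k \<in> carrier (G k)" if "f \<in> A" "k < n" for f k
    using subsetD[OF A_sub that(1)] that(2) by simp
  have A_undefined: "f k = undefined" if "f \<in> A" "\<not> k < n" for f k
    using subsetD[OF A_sub that(1)] that(2) by simp
  have inj: "inj_on \<tau> A"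
  proof (rule inj_onI)
    fix f g assume fg: "f \<in> A" "g \<in> A" "\<tau> f = \<tau> g"
    show "f = g"
    proof
      fix k
      interpret Gk: comm_group "G k" by (rule G)
      show "f k = g k"
      proof (cases "k < n")
        case True
        then have "z k \<otimes>\<^bsub>G k\<^esub> f k = z k \<otimes>\<^bsub>G k\<^esub> g k" using fun_cong[OF fg(3), of k] by (simp add: \<tau>_def)
        moreover have "f k \<in> carrier (G k)" "g k \<in> carrier (G k)"
          using fg True A_carrier by auto
        ultimately show ?thesis using zc[of k] by simp
      next
        case False
        then show ?thesis using A_undefined[OF fg(1)] A_undefined[OF fg(2)] by simp
      qed
    qed
  qed
  have le: "b * pmf R f \<le> pmf R (\<tau> f)" if f: "f \<in> A" for f
  proof -
    note f' = A_carrier[OF f] and fu = A_undefined[OF f]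
    have "b * pmf R f = b * (\<Prod>k<n. pmf (p k) (f k))"
      unfolding R_def using fu by (subst pmf_Pi) auto
    also have "\<dots> \<le> (\<Prod>k<n. c k) * (\<Prod>k<n. pmf (p k) (f k))"
      by (intro mult_right_mono c prod_nonneg) auto
    also have "\<dots> = (\<Prod>k<n. c k * pmf (p k) (f k))"
      by (simp add: prod.distrib)
    also have "\<dots> \<le> (\<Prod>k<n. pmf (p k) (z k \<otimes>\<^bsub>G k\<^esub> f k))"
    proof (rule prod_mono)
      fix k assume "k \<in> {..<n}"
      interpret Gk: comm_group "G k" by (rule G)
      show "0 \<le> c k * pmf (p k) (f k) \<and> c k * pmf (p k) (f k) \<le> pmf (p k) (z k \<otimes>\<^bsub>G k\<^esub> f k)"
        using Z(2)[OF z, of k] f'[of k] \<open>k \<in> {..<n}\<close> c unfolding Gk.quasi_inv_def by simp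
    qed
    also have "\<dots> = pmf R (\<tau> f)"
      unfolding R_def by (subst pmf_Pi) (auto simp: \<tau>_def)
    finally show ?thesis .
  qed
  \<comment> \<open>The assumptions bound \<open>b\<close> only from above; for negative
    \<open>b\<close> the claim is trivial and is treated at the end.\<close>
  have b: "b * measure_pmf.prob R A \<le> measure_pmf.prob R (\<tau> ` A)" if "0 \<le> b"
    by (rule pmf_shift_measure_ge[OF inj that le])
  have "\<tau> ` A \<subseteq> e -` (S \<inter> carrier ?P)"
  proof
    fix h assume "h \<in> \<tau> ` A"
    then obtain f where f: "f \<in> A" "h = \<tau> f" by blast
    have "\<forall>k\<in>{..<n}. (z \<otimes>\<^bsub>?P\<^esub> e f) k = e (\<tau> f) k"
      by (simp add: e_def \<tau>_def)
    then have "z \<otimes>\<^bsub>?P\<^esub> e f \<in> S \<longleftrightarrow> e (\<tau> f) \<in> S"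
      using S unfolding cylinder_def by blast
    moreover have "e (\<tau> f) k \<in> carrier (G k)" for k
    proof -
      interpret Gk: comm_group "G k" by (rule G)
      show ?thesis using A_carrier[OF f(1)] zc[of k] by (simp add: e_def \<tau>_def)
    qed
    ultimately show "h \<in> e -` (S \<inter> carrier ?P)"
      using f unfolding A_def by (simp add: PiE_iff)
  qed
  then have "measure_pmf.prob R (\<tau> ` A) \<le> measure_pmf.prob \<mu> (S \<inter> carrier (product_group UNIV G))"
    unfolding \<mu>_def by (simp add: measure_pmf.finite_measure_mono)
  moreover have "measure_pmf.prob \<mu> {x \<in> carrier ?P. z \<otimes>\<^bsub>?P\<^esub> x \<in> S} \<le> measure_pmf.prob R A"
  proof -
    have "measure_pmf.prob \<mu> {x \<in> carrier ?P. z \<otimes>\<^bsub>?P\<^esub> x \<in> S}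
        = measure_pmf.prob R (e -` {x \<in> carrier ?P. z \<otimes>\<^bsub>?P\<^esub> x \<in> S})"
      by (simp only: \<mu>_def measure_map_pmf)
    also have "\<dots> \<le> measure_pmf.prob R A"
      by (intro measure_pmf.finite_measure_mono_AE) (auto simp: AE_measure_pmf_iff A_def)
    finally show ?thesis .
  qed
  ultimately show "b * measure_pmf.prob \<mu> {x \<in> carrier ?P. z \<otimes>\<^bsub>?P\<^esub> x \<in> S} \<le> measure_pmf.prob \<mu> (S \<inter> carrier (product_group UNIV G))"
  proof (cases "0 \<le> b")
    case True
    assume "measure_pmf.prob R (\<tau> ` A) \<le> measure_pmf.prob \<mu> (S \<inter> carrier (product_group UNIV G))"
      "measure_pmf.prob \<mu> {x \<in> carrier ?P. z \<otimes>\<^bsub>?P\<^esub> x \<in> S} \<le> measure_pmf.prob R A"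
    with b[OF True] True show ?thesis by (meson mult_left_mono order_trans)
  next
    case False
    then have "b * measure_pmf.prob \<mu> {x \<in> carrier ?P. z \<otimes>\<^bsub>?P\<^esub> x \<in> S} \<le> 0"
      by (simp add: mult_nonpos_nonneg)
    then show ?thesis by (rule order_trans) simp
  qed
qed

section \<open>Passage from finite stages to all translations by compactness\<close>

lemma compact_unit_functions: "compact {q :: 'b \<Rightarrow> real. \<forall>S. 0 \<le> q S \<and> q S \<le> 1}"
proof -
  have "compactin (product_topology (\<lambda>_. euclidean) UNIV) (\<Pi>\<^sub>E S\<in>(UNIV :: 'b set). {0..1::real})"
    by (subst compactin_PiE) simp
  moreover have "(\<Pi>\<^sub>E S\<in>(UNIV :: 'b set). {0..1::real}) = {q. \<forall>S. 0 \<le> q S \<and> q S \<le> 1}"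
    by (auto simp: PiE_iff)
  ultimately show ?thesis by (simp add: euclidean_product_topology)
qed

text \<open>Discrete measures are defined on all subsets, so each stage is a point of the compact
  space of functions into the unit interval. The requirements are closed conditions, and finitely
  many of them are met by one stage.\<close>

lemma ex_quasi_inv_finitely_additive:
  fixes G :: "nat \<Rightarrow> ('a, 'm) monoid_scheme"
  assumes G: "\<And>k. comm_group (G k)"
    and V: "\<And>k. V k \<subseteq> carrier (G k)" and L: "\<And>k. \<one>\<^bsub>G k\<^esub> \<in> L k"
    and c: "\<And>k. 0 \<le> c k" "\<And>n. b \<le> (\<Prod>k<n. c k)"
    and p: "\<And>k. \<forall>Z. finite Z \<and> Z \<subseteq> V k \<longrightarrow> (\<exists>p. set_pmf p \<subseteq> carrier (G k) \<and>
      c k \<le> measure_pmf.prob p (L k) \<and> (\<forall>z\<in>Z. comm_group.quasi_inv (G k) (c k) p z))"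
    and Q: "Q \<subseteq> (\<Pi>\<^sub>E k\<in>UNIV. V k)"
  shows "\<exists>q :: (nat \<Rightarrow> 'a) set \<Rightarrow> real. (\<forall>S. 0 \<le> q S \<and> q S \<le> 1) \<and>
    (\<forall>S S'. S \<inter> S' = {} \<longrightarrow> q (S \<union> S') = q S + q S') \<and>
    (\<forall>S. (\<Pi>\<^sub>E k\<in>UNIV. L k) \<subseteq> S \<longrightarrow> b \<le> q S) \<and>
    (\<forall>n z S. z \<in> Q \<longrightarrow> cylinder {..<n} S \<longrightarrow>
      b * q {x \<in> carrier (product_group UNIV G). z \<otimes>\<^bsub>product_group UNIV G\<^esub> x \<in> S}
        \<le> q (S \<inter> carrier (product_group UNIV G)))"
proof -
  let ?P = "product_group UNIV G"
  \<comment> \<open>\<open>K\<close> collects the requirements that do not mention \<open>z\<close>;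
    the sets \<open>f (n, z)\<close> express quasi-invariance under \<open>z\<close> on cylinders
    over the first \<open>n\<close> coordinates.\<close>
  define K where "K = {q :: (nat \<Rightarrow> 'a) set \<Rightarrow> real. \<forall>S. 0 \<le> q S \<and> q S \<le> 1} \<inter>
    ({q. \<forall>S S'. S \<inter> S' = {} \<longrightarrow> q (S \<union> S') = q S + q S'} \<inter>
     {q. \<forall>S. (\<Pi>\<^sub>E k\<in>UNIV. L k) \<subseteq> S \<longrightarrow> b \<le> q S})"
  define f where "f = (\<lambda>(n, z). {q :: (nat \<Rightarrow> 'a) set \<Rightarrow> real. \<forall>S. cylinder {..<n::nat} S \<longrightarrow>
      b * q {x \<in> carrier ?P. z \<otimes>\<^bsub>?P\<^esub> x \<in> S} \<le> q (S \<inter> carrier (product_group UNIV G))})"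
  have "compact K"
    unfolding K_def
    by (intro compact_Int_closed compact_unit_functions closed_Int closed_Collect_all closed_Collect_imp
        open_Collect_const closed_Collect_eq closed_Collect_le continuous_intros continuous_on_product_coordinates)
  moreover have "closed (f i)" for i
    unfolding f_def split_def
    by (intro closed_Collect_all closed_Collect_imp open_Collect_const
        closed_Collect_le continuous_intros continuous_on_product_coordinates)
  moreover have "K \<inter> (\<Inter>i\<in>I. f i) \<noteq> {}" if I: "finite I" "I \<subseteq> UNIV \<times> Q" for I
  proof -
    \<comment> \<open>Cylinders over fewer coordinates are also cylinders over the first
      \<open>n\<close>, so one common \<open>n\<close> serves all chosen conditions.\<close>
    obtain n where n: "\<And>i. i \<in> I \<Longrightarrow> fst i \<le> n"
      using finite_nat_set_iff_bounded_le[of "fst ` I"] I(1) by auto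
    define Z where "Z = snd ` I"
    have Z: "finite Z" "Z \<subseteq> Q" using I unfolding Z_def by auto
    have "\<exists>p. set_pmf p \<subseteq> carrier (G k) \<and> c k \<le> measure_pmf.prob p (L k) \<and>
        (\<forall>z\<in>(\<lambda>z. z k) ` Z. comm_group.quasi_inv (G k) (c k) p z)" for k
      by (rule p[rule_format]) (use Z Q in \<open>auto simp: PiE_iff subset_iff\<close>)
    then obtain p where p': "\<And>k. set_pmf (p k) \<subseteq> carrier (G k)"
      "\<And>k. c k \<le> measure_pmf.prob (p k) (L k)"
      "\<And>k z. z \<in> Z \<Longrightarrow> comm_group.quasi_inv (G k) (c k) (p k) (z k)"
      by (metis image_eqI)
    have Zc: "Z \<subseteq> carrier ?P" using Z Q V by (fastforce simp: PiE_iff)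
    have "\<exists>\<mu>. b \<le> measure_pmf.prob \<mu> (\<Pi>\<^sub>E k\<in>UNIV. L k) \<and> (\<forall>z S. z \<in> Z \<longrightarrow> cylinder {..<n} S \<longrightarrow>
        b * measure_pmf.prob \<mu> {x \<in> carrier ?P. z \<otimes>\<^bsub>?P\<^esub> x \<in> S} \<le> measure_pmf.prob \<mu> (S \<inter> carrier (product_group UNIV G)))"
    proof (rule ex_pmf_product_stage[where G = G and p = p and c = c and Z = Z and L = L and n = n and b = b])
      fix \<mu>
      assume "b \<le> measure_pmf.prob \<mu> (\<Pi>\<^sub>E k\<in>UNIV. L k)"
        "\<And>z S. \<lbrakk>z \<in> Z; cylinder {..<n} S\<rbrakk> \<Longrightarrow>
          b * measure_pmf.prob \<mu> {x \<in> carrier ?P. z \<otimes>\<^bsub>?P\<^esub> x \<in> S} \<le> measure_pmf.prob \<mu> (S \<inter> carrier (product_group UNIV G))"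
      then show ?thesis by blast
    qed (rule G p' L c Zc; assumption?)+
    then obtain \<mu> where \<mu>: "b \<le> measure_pmf.prob \<mu> (\<Pi>\<^sub>E k\<in>UNIV. L k)"
      "\<forall>z S. z \<in> Z \<longrightarrow> cylinder {..<n} S \<longrightarrow>
        b * measure_pmf.prob \<mu> {x \<in> carrier ?P. z \<otimes>\<^bsub>?P\<^esub> x \<in> S} \<le> measure_pmf.prob \<mu> (S \<inter> carrier (product_group UNIV G))"
      by (elim exE conjE)
    have "measure_pmf.prob \<mu> \<in> K"
      unfolding K_def using \<mu>(1)
      by (auto simp: measure_pmf.finite_measure_Union intro: order_trans[OF _ measure_pmf.finite_measure_mono])
    moreover have "measure_pmf.prob \<mu> \<in> f i" if "i \<in> I" for i
    proof -
      have i: "fst i \<le> n" "snd i \<in> Z" using that n Z_def by auto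
      show ?thesis
        unfolding f_def split_def
      proof (intro CollectI allI impI)
        fix S :: "(nat \<Rightarrow> 'a) set" assume "cylinder {..<fst i} S"
        then have "cylinder {..<n} S" by (rule cylinder_mono) (use i in auto)
        then show "b * measure_pmf.prob \<mu> {x \<in> carrier ?P. snd i \<otimes>\<^bsub>?P\<^esub> x \<in> S} \<le> measure_pmf.prob \<mu> (S \<inter> carrier (product_group UNIV G))"
          using \<mu>(2) i(2) by blast
      qed
    qed
    ultimately show ?thesis by blast
  qed
  ultimately have "K \<inter> (\<Inter>i\<in>UNIV \<times> Q. f i) \<noteq> {}"
    by (rule compact_imp_fip_image)
  then obtain q where "q \<in> K \<inter> (\<Inter>i\<in>UNIV \<times> Q. f i)" by (meson ex_in_conv)
  then have q: "q \<in> K" "\<And>n z. z \<in> Q \<Longrightarrow> q \<in> f (n, z)" by auto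
  show ?thesis
  proof (intro exI[of _ q] conjI[rotated] allI impI)
    fix n :: nat and z and S :: "(nat \<Rightarrow> 'a) set" assume "z \<in> Q" "cylinder {..<n} S"
    with q(2)[of z n] show "b * q {x \<in> carrier ?P. z \<otimes>\<^bsub>?P\<^esub> x \<in> S} \<le> q (S \<inter> carrier ?P)"
      by (simp add: f_def)
  qed (use q(1) in \<open>simp_all add: K_def\<close>)
qed


section \<open>Contents from open cylinders\<close>

definition open_cylinder :: "('i \<Rightarrow> 'a topology) \<Rightarrow> ('i \<Rightarrow> 'a) set \<Rightarrow> bool" where
  "open_cylinder T W \<longleftrightarrow> openin (product_topology T UNIV) W \<and>
    (\<exists>J S. finite J \<and> cylinder J S \<and> W = topspace (product_topology T UNIV) \<inter> S)"

lemma open_cylinder_topspace: "open_cylinder T (topspace (product_topology T UNIV))"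
  unfolding open_cylinder_def
  by (intro conjI openin_topspace exI[of _ "{}"] exI[of _ UNIV]) (auto simp: cylinder_def)

lemma open_cylinder_Int_Un:
  assumes "open_cylinder T V" "open_cylinder T W"
  shows open_cylinder_Int: "open_cylinder T (V \<inter> W)" and open_cylinder_Un: "open_cylinder T (V \<union> W)"
proof -
  obtain J S J' S' where *: "finite J" "cylinder J S" "V = topspace (product_topology T UNIV) \<inter> S"
    "finite J'" "cylinder J' S'" "W = topspace (product_topology T UNIV) \<inter> S'"
    using assms unfolding open_cylinder_def by blast
  have c: "cylinder (J \<union> J') S" "cylinder (J \<union> J') S'"
    using cylinder_mono[OF *(2)] cylinder_mono[OF *(5)] by auto
  show "open_cylinder T (V \<inter> W)"
    unfolding open_cylinder_def
  proof (intro conjI exI)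
    show "openin (product_topology T UNIV) (V \<inter> W)"
      using assms unfolding open_cylinder_def by (intro openin_Int) auto
    show "finite (J \<union> J')" using * by simp
    show "cylinder (J \<union> J') (S \<inter> S')" using c by (rule cylinder_Int)
    show "V \<inter> W = topspace (product_topology T UNIV) \<inter> (S \<inter> S')" using * by auto
  qed
  show "open_cylinder T (V \<union> W)"
    unfolding open_cylinder_def
  proof (intro conjI exI)
    show "openin (product_topology T UNIV) (V \<union> W)"
      using assms unfolding open_cylinder_def by (intro openin_Un) auto
    show "finite (J \<union> J')" using * by simp
    show "cylinder (J \<union> J') (S \<union> S')" using c by (rule cylinder_Un)
    show "V \<union> W = topspace (product_topology T UNIV) \<inter> (S \<union> S')" using * by auto
  qed
qed

lemma open_cylinder_Union:
  assumes "finite \<F>" "\<And>W. W \<in> \<F> \<Longrightarrow> open_cylinder T W" shows "open_cylinder T (\<Union>\<F>)"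
  using assms
proof (induction \<F>)
  case empty
  show ?case unfolding open_cylinder_def
    by (intro conjI exI[of _ "{}"]) (auto simp: cylinder_def)
next
  case (insert W \<F>)
  then show ?case using open_cylinder_Un[of T W "\<Union>\<F>"] by simp
qed

text \<open>Basic open boxes restrict only finitely many coordinates, so they are open cylinders,
  and finitely many of them inside \<open>W\<close> cover \<open>C\<close>.\<close>

lemma compact_open_cylinder:
  assumes C: "compactin (product_topology T UNIV) C" and W: "openin (product_topology T UNIV) W" "C \<subseteq> W"
  obtains N where "open_cylinder T N" "C \<subseteq> N" "N \<subseteq> W"
proof -
  let ?T = "product_topology T UNIV"
  let ?\<U> = "{N. open_cylinder T N \<and> N \<subseteq> W}"
  have "\<exists>N\<in>?\<U>. x \<in> N" if x: "x \<in> W" for x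
  proof -
    obtain U where U: "finite {i. U i \<noteq> topspace (T i)}" "\<And>i. openin (T i) (U i)" "x \<in> Pi\<^sub>E UNIV U" "Pi\<^sub>E UNIV U \<subseteq> W"
      using W(1) x unfolding openin_product_topology_alt by auto
    let ?J = "{i. U i \<noteq> topspace (T i)}"
    have "openin ?T (Pi\<^sub>E UNIV U)"
      using U by (auto simp: openin_PiE_gen)
    moreover have "cylinder ?J {y. \<forall>i\<in>?J. y i \<in> U i}"
      unfolding cylinder_def by auto
    moreover have "Pi\<^sub>E UNIV U = topspace ?T \<inter> {y. \<forall>i\<in>?J. y i \<in> U i}"
      using openin_subset[OF U(2)] by (fastforce simp: PiE_iff)
    ultimately have "open_cylinder T (Pi\<^sub>E UNIV U)"
      unfolding open_cylinder_def using U(1) by blast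
    then show ?thesis using U by blast
  qed
  then have cover: "C \<subseteq> \<Union>?\<U>" using W(2) by blast
  have "\<exists>\<F>. finite \<F> \<and> \<F> \<subseteq> ?\<U> \<and> C \<subseteq> \<Union>\<F>"
    by (rule compactinD[OF C _ cover]) (simp add: open_cylinder_def)
  then obtain \<F> where \<F>: "finite \<F>" "\<F> \<subseteq> ?\<U>" "C \<subseteq> \<Union>\<F>"
    by (elim exE conjE)
  show thesis
  proof (rule that[of "\<Union>\<F>"])
    show "open_cylinder T (\<Union>\<F>)" using \<F> by (intro open_cylinder_Union) auto
  qed (use \<F> in auto)
qed

text \<open>The finitely additive \<open>q\<close> is used through open cylinders only: there its
  quasi-invariance is known, and they suffice to approximate compact sets from outside.\<close>

definition cylinder_content :: "('i \<Rightarrow> 'a topology) \<Rightarrow> (('i \<Rightarrow> 'a) set \<Rightarrow> real) \<Rightarrow> ('i \<Rightarrow> 'a) set \<Rightarrow> ennreal" where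
  "cylinder_content T q C = (INF W\<in>{W. open_cylinder T W \<and> C \<subseteq> W}. ennreal (q W))"

lemma cylinder_content_le:
  "open_cylinder T W \<Longrightarrow> C \<subseteq> W \<Longrightarrow> cylinder_content T q C \<le> ennreal (q W)"
  unfolding cylinder_content_def by (rule INF_lower) simp

lemma cylinder_content_greatest:
  "(\<And>W. open_cylinder T W \<Longrightarrow> C \<subseteq> W \<Longrightarrow> r \<le> ennreal (q W)) \<Longrightarrow> r \<le> cylinder_content T q C"
  unfolding cylinder_content_def by (rule INF_greatest) auto

text \<open>Subadditivity comes from unions of cylinders, superadditivity from separating disjoint
  sets by disjoint cylinders. Regularity is built in: a nearly optimal cylinder for \<open>C\<close>
  also bounds the content of every closed \<open>D\<close> inside it.\<close>

lemma regular_content_cylinder_content: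
  fixes T :: "'i \<Rightarrow> 'a topology"
  assumes q: "\<And>S. 0 \<le> q S" "\<And>S S'. S \<inter> S' = {} \<Longrightarrow> q (S \<union> S') = q S + q S'"
    and T: "regular_space (product_topology T UNIV)"
    and M: "closedin (product_topology T UNIV) M" "compactin (product_topology T UNIV) M"
  shows "regular_content (product_topology T UNIV) M (cylinder_content T q)"
proof -
  let ?T = "product_topology T UNIV" and ?\<kappa> = "cylinder_content T q"
  have q_mono: "q S \<le> q S'" if "S \<subseteq> S'" for S S'
    using q(2)[of S "S' - S"] q(1)[of "S' - S"] that by (simp add: Un_absorb1)
  have q_sub: "q (S \<union> S') \<le> q S + q S'" for S S'
    using q(2)[of S "S' - S"] q_mono[of "S' - S" S'] by auto
  have fin: "?\<kappa> C < \<infinity>" if "C \<subseteq> topspace ?T" for C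
    using cylinder_content_le[OF open_cylinder_topspace that, of q]
    by (rule le_less_trans) simp
  have approx: "\<exists>W. open_cylinder T W \<and> C \<subseteq> W \<and> ennreal (q W) \<le> ?\<kappa> C + ennreal e"
    if "C \<subseteq> topspace ?T" "0 < e" for C e
  proof -
    have "?\<kappa> C < ?\<kappa> C + ennreal e"
      using fin[OF that(1)] that(2) by (simp add: ennreal_add_left_cancel_less)
    then obtain W where "open_cylinder T W" "C \<subseteq> W" "ennreal (q W) < ?\<kappa> C + ennreal e"
      unfolding cylinder_content_def INF_less_iff by auto
    then show ?thesis by force
  qed
  have mono: "?\<kappa> C \<le> ?\<kappa> D" if "C \<subseteq> D" for C D
    by (rule cylinder_content_greatest) (use that in \<open>auto intro: cylinder_content_le\<close>)
  have sub: "?\<kappa> (C \<union> D) \<le> ?\<kappa> C + ?\<kappa> D" if CD: "C \<subseteq> topspace ?T" "D \<subseteq> topspace ?T" for C D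
  proof (rule ennreal_le_epsilon)
    fix e :: real assume "0 < e"
    then obtain V W where V: "open_cylinder T V" "C \<subseteq> V" "ennreal (q V) \<le> ?\<kappa> C + ennreal (e/2)"
      and W: "open_cylinder T W" "D \<subseteq> W" "ennreal (q W) \<le> ?\<kappa> D + ennreal (e/2)"
      using approx[OF CD(1), of "e/2"] approx[OF CD(2), of "e/2"] by auto
    have "?\<kappa> (C \<union> D) \<le> ennreal (q (V \<union> W))"
      using V W by (intro cylinder_content_le open_cylinder_Un) auto
    also have "\<dots> \<le> ennreal (q V) + ennreal (q W)"
      using q_sub q(1) by (simp add: ennreal_leI flip: ennreal_plus)
    also have "\<dots> \<le> (?\<kappa> C + ennreal (e/2)) + (?\<kappa> D + ennreal (e/2))"
      by (intro add_mono V W)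
    also have "\<dots> = ?\<kappa> C + ?\<kappa> D + (ennreal (e/2) + ennreal (e/2))" by (simp add: ac_simps)
    also have "\<dots> = ?\<kappa> C + ?\<kappa> D + ennreal e" using \<open>0 < e\<close> by (simp flip: ennreal_plus)
    finally show "?\<kappa> (C \<union> D) \<le> ?\<kappa> C + ?\<kappa> D + ennreal e" .
  qed
  have super: "?\<kappa> C + ?\<kappa> D \<le> ?\<kappa> (C \<union> D)"
    if C: "closedin ?T C" "C \<subseteq> M" and D: "closedin ?T D" "D \<subseteq> M" and CD: "C \<inter> D = {}" for C D
  proof (rule cylinder_content_greatest)
    fix W assume W: "open_cylinder T W" "C \<union> D \<subseteq> W"
    have comp: "compactin ?T C" "compactin ?T D"
      using C D M closed_compactin by blast+
    have "disjnt C D" using CD by (simp add: disjnt_def)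
    from regular_space_compact_closed_separation[OF T comp(1) D(1) this]
    obtain U U' where U: "openin ?T U" "openin ?T U'" "C \<subseteq> U" "D \<subseteq> U'" "disjnt U U'"
      by (elim exE conjE)
    \<comment> \<open>Any competitor \<open>W\<close> for the union is cut by two disjoint open
      cylinders, so that finite additivity of \<open>q\<close> applies inside
      \<open>W\<close>.\<close>
    obtain N where N: "open_cylinder T N" "C \<subseteq> N" "N \<subseteq> U"
      by (rule compact_open_cylinder[OF comp(1) U(1,3)])
    obtain N' where N': "open_cylinder T N'" "D \<subseteq> N'" "N' \<subseteq> U'"
      by (rule compact_open_cylinder[OF comp(2) U(2,4)])
    have "?\<kappa> C + ?\<kappa> D \<le> ennreal (q (W \<inter> N)) + ennreal (q (W \<inter> N'))"
      using W N N' by (intro add_mono cylinder_content_le open_cylinder_Int) auto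
    also have "\<dots> = ennreal (q ((W \<inter> N) \<union> (W \<inter> N')))"
      using U N N' by (subst q(2)) (auto simp: disjnt_def q(1))
    also have "\<dots> \<le> ennreal (q W)" by (intro ennreal_leI q_mono) auto
    finally show "?\<kappa> C + ?\<kappa> D \<le> ennreal (q W)" .
  qed
  show ?thesis
  proof
    show "regular_space ?T" "closedin ?T M" "compactin ?T M" by fact+
    show "?\<kappa> M < \<infinity>" using M(1) by (intro fin closedin_subset)
    fix C D assume C: "closedin ?T C"
    show "?\<kappa> C \<le> ?\<kappa> D" if "C \<subseteq> D" using that by (rule mono)
    {
      assume D: "closedin ?T D" and sub_M: "C \<subseteq> M" "D \<subseteq> M"
      show le: "?\<kappa> (C \<union> D) \<le> ?\<kappa> C + ?\<kappa> D"
        using C D by (intro sub closedin_subset)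
      show "?\<kappa> (C \<union> D) = ?\<kappa> C + ?\<kappa> D" if "C \<inter> D = {}"
        by (intro antisym le super C D sub_M that)
    }
    fix e :: real assume e: "0 < e"
    obtain W where W: "open_cylinder T W" "C \<subseteq> W" "ennreal (q W) \<le> ?\<kappa> C + ennreal e"
      using approx[OF closedin_subset[OF C] e] by (elim exE conjE)
    show "\<exists>U. openin ?T U \<and> C \<subseteq> U \<and> (\<forall>D. closedin ?T D \<and> D \<subseteq> M \<and> D \<subseteq> U \<longrightarrow> ?\<kappa> D \<le> ?\<kappa> C + ennreal e)"
    proof (intro exI[of _ W] conjI allI impI)
      show "openin ?T W" using W by (simp add: open_cylinder_def)
      fix D assume "closedin ?T D \<and> D \<subseteq> M \<and> D \<subseteq> W"
      then have "?\<kappa> D \<le> ennreal (q W)" by (intro cylinder_content_le W) auto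
      then show "?\<kappa> D \<le> ?\<kappa> C + ennreal e" using W(3) by (rule order_trans)
    qed (rule W)
  qed
qed


section \<open>Quasi-invariant Radon measures on products\<close>

text \<open>The one-factor result with closed compact sets: \<open>L\<close> contains the power of
  \<open>V\<close> on which the measures concentrate, and \<open>M\<close> is large enough to hold
  all translates of \<open>L\<close> by \<open>V\<close>.\<close>

lemma (in abelian_top_group) ex_concentrating_sets:
  assumes lc: "locally_compact_space T" and Q: "compactin T Q" and c: "0 < c" "c < 1"
  shows "\<exists>V L M. Q \<subseteq> V \<and> V \<subseteq> carrier G \<and> \<one> \<in> L \<and> closedin T L \<and> compactin T L \<and>
    closedin T M \<and> compactin T M \<and> L \<subseteq> M \<and> V <#> L \<subseteq> M \<and>
    (\<forall>Z. finite Z \<and> Z \<subseteq> V \<longrightarrow> (\<exists>p. set_pmf p \<subseteq> carrier G \<and>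
      c \<le> measure_pmf.prob p L \<and> (\<forall>z\<in>Z. quasi_inv c p z)))"
proof -
  obtain V F where V: "compactin T V" "Q \<subseteq> V" "\<one> \<in> V"
    and F: "finite F" "F \<subseteq> carrier G" "V <#> V \<subseteq> V <#> F"
    by (rule compact_covering[OF lc Q])
  have Vc: "V \<subseteq> carrier G" using compactin_subset_topspace[OF V(1)] by (simp add: topspace_eq)
  obtain N where N: "\<forall>Z. finite Z \<and> Z \<subseteq> V \<longrightarrow> (\<exists>p. set_pmf p \<subseteq> carrier G \<and>
    c \<le> measure_pmf.prob p (ball_pow V N) \<and> (\<forall>z\<in>Z. quasi_inv c p z))"
    using ex_quasi_inv_concentrated[OF Vc V(3) F c] by (elim exE)
  have "compactin T (ball_pow V n)" for n
    by (induction n) (simp_all add: V compactin_set_mult)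
  then obtain L where L: "compactin T L" "closedin T L" "ball_pow V N \<subseteq> L"
    using compact_subset_closed_compact[OF lc] by metis
  obtain M where M: "compactin T M" "closedin T M" "V <#> L \<subseteq> M"
    using compact_subset_closed_compact[OF lc compactin_set_mult[OF V(1) L(1)]] by metis
  have Lc: "L \<subseteq> carrier G" using compactin_subset_topspace[OF L(1)] by (simp add: topspace_eq)
  have "L \<subseteq> M"
  proof
    fix x assume x: "x \<in> L"
    then have "x = \<one> \<otimes> x" using Lc by auto
    then have "x \<in> V <#> L" using V(3) x unfolding set_mult_def by blast
    then show "x \<in> M" using M(3) by blast
  qed
  moreover have "\<one> \<in> L" using L(3) ball_pow_mono[OF V(3) Vc, of 0 N] V(3) by auto
  moreover have "\<exists>p. set_pmf p \<subseteq> carrier G \<and> c \<le> measure_pmf.prob p L \<and> (\<forall>z\<in>Z. quasi_inv c p z)"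
    if Z: "finite Z \<and> Z \<subseteq> V" for Z
  proof -
    obtain p where p: "set_pmf p \<subseteq> carrier G" "c \<le> measure_pmf.prob p (ball_pow V N)" "\<forall>z\<in>Z. quasi_inv c p z"
      using N Z by blast
    have "measure_pmf.prob p (ball_pow V N) \<le> measure_pmf.prob p L"
      using L(3) by (intro measure_pmf.finite_measure_mono) auto
    then show ?thesis using p by (intro exI[of _ p]) auto
  qed
  ultimately show ?thesis using V(2) Vc L M by (intro exI[of _ V] exI[of _ L] exI[of _ M]) auto
qed

lemma prod_two_powr: "(\<Prod>k<n. 2 powr - ((1/2) ^ Suc k)) = 2 powr ((1/2) ^ n - 1 :: real)"
proof (induction n)
  case (Suc n)
  then show ?case by (simp flip: powr_add)
qed simp

text \<open>Products of the sets from the single factors carry the content. Quasi-invariance of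
  \<open>q\<close> on cylinders passes to the infimum because the inverse translate of an open
  cylinder around \<open>z C\<close> is an open cylinder around \<open>C\<close>.\<close>

lemma ex_quasi_inv_regular_content:
  fixes G :: "nat \<Rightarrow> ('a, 'm) monoid_scheme" and T :: "nat \<Rightarrow> 'a topology"
  defines "GX \<equiv> product_group UNIV G" and "TX \<equiv> product_topology T UNIV"
  assumes G: "\<And>k. abelian_topological_group (G k) (T k)" and lc: "\<And>k. locally_compact_space (T k)"
    and Q: "compactin TX Q"
  shows "\<exists>M \<kappa> L. regular_content TX M \<kappa> \<and> closedin TX L \<and> L \<subseteq> M \<and> 0 < \<kappa> L \<and>
    (\<forall>z\<in>Q. (\<lambda>x. z \<otimes>\<^bsub>GX\<^esub> x) ` L \<subseteq> M) \<and>
    (\<forall>z\<in>Q. \<forall>C. closedin TX C \<longrightarrow> \<kappa> C \<le> 2 * \<kappa> ((\<lambda>x. z \<otimes>\<^bsub>GX\<^esub> x) ` C))"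
proof -
  have grp: "abelian_top_group (G k) (T k)" for k
    using G abelian_top_group_iff by blast
  have cg: "comm_group (G k)" for k
    using G unfolding abelian_topological_group_def by blast
  interpret X: abelian_top_group GX TX
    unfolding GX_def TX_def abelian_top_group_iff
    by (rule abelian_topological_group_product) (rule G)
  have QX: "Q \<subseteq> carrier GX"
    using compactin_subset_topspace[OF Q] X.topspace_eq by simp
  \<comment> \<open>The exponents sum to 1, so all partial products stay above 1/2; this is the
    constant of quasi-invariance on the whole product.\<close>
  define c where "c k = 2 powr - ((1/2) ^ Suc k :: real)" for k
  have c: "0 < c k" "c k < 1" for k
    by (auto simp: c_def powr_less_one)
  have c_prod: "1/2 \<le> (\<Prod>k<n. c k)" for n
  proof -
    have "(2::real) powr (-1) \<le> 2 powr ((1/2) ^ n - 1)" by (intro powr_mono) auto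
    then show ?thesis unfolding c_def prod_two_powr by (simp add: powr_minus)
  qed
  define R where "R k V L M \<longleftrightarrow> (\<lambda>x. x k) ` Q \<subseteq> V \<and> V \<subseteq> carrier (G k) \<and> \<one>\<^bsub>G k\<^esub> \<in> L \<and> closedin (T k) L \<and> compactin (T k) L \<and>
    closedin (T k) M \<and> compactin (T k) M \<and> L \<subseteq> M \<and> V <#>\<^bsub>G k\<^esub> L \<subseteq> M \<and>
    (\<forall>Z. finite Z \<and> Z \<subseteq> V \<longrightarrow> (\<exists>p. set_pmf p \<subseteq> carrier (G k) \<and>
      c k \<le> measure_pmf.prob p L \<and> (\<forall>z\<in>Z. comm_group.quasi_inv (G k) (c k) p z)))" for k V L M
  have "\<exists>V L M. R k V L M" for k
  proof -
    have "compactin (T k) ((\<lambda>x. x k) ` Q)"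
      using Q unfolding TX_def by (rule image_compactin) (simp add: continuous_map_product_projection)
    from abelian_top_group.ex_concentrating_sets[OF grp lc this c]
    show ?thesis unfolding R_def .
  qed
  then obtain V L M where RVLM: "\<And>k. R k (V k) (L k) (M k)" by metis
  have V: "V k \<subseteq> carrier (G k)" and L: "\<one>\<^bsub>G k\<^esub> \<in> L k" "closedin (T k) (L k)" "compactin (T k) (L k)"
    and M: "closedin (T k) (M k)" "compactin (T k) (M k)" "L k \<subseteq> M k" "V k <#>\<^bsub>G k\<^esub> L k \<subseteq> M k"
    and QV: "(\<lambda>x. x k) ` Q \<subseteq> V k" for k
    using RVLM[of k] by (simp_all add: R_def)
  have p: "\<forall>Z. finite Z \<and> Z \<subseteq> V k \<longrightarrow> (\<exists>p. set_pmf p \<subseteq> carrier (G k) \<and>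
      c k \<le> measure_pmf.prob p (L k) \<and> (\<forall>z\<in>Z. comm_group.quasi_inv (G k) (c k) p z))" for k
    using RVLM[of k] by (simp add: R_def)
  have QV': "Q \<subseteq> (\<Pi>\<^sub>E k\<in>UNIV. V k)"
    using QV by (auto simp: PiE_iff)
  from ex_quasi_inv_finitely_additive[OF cg V L(1) less_imp_le[OF c(1)] c_prod p QV', folded GX_def]
  obtain q :: "(nat \<Rightarrow> 'a) set \<Rightarrow> real" where "\<forall>S. 0 \<le> q S \<and> q S \<le> 1"
    "\<forall>S S'. S \<inter> S' = {} \<longrightarrow> q (S \<union> S') = q S + q S'"
    "\<forall>S. (\<Pi>\<^sub>E k\<in>UNIV. L k) \<subseteq> S \<longrightarrow> 1/2 \<le> q S"
    "\<forall>n z S. z \<in> Q \<longrightarrow> cylinder {..<n} S \<longrightarrow>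
      1/2 * q {x \<in> carrier GX. z \<otimes>\<^bsub>GX\<^esub> x \<in> S} \<le> q (S \<inter> carrier GX)"
    by (elim exE conjE)
  then have q: "\<And>S. 0 \<le> q S" "\<And>S S'. S \<inter> S' = {} \<Longrightarrow> q (S \<union> S') = q S + q S'"
    "\<And>S. (\<Pi>\<^sub>E k\<in>UNIV. L k) \<subseteq> S \<Longrightarrow> 1/2 \<le> q S"
    "\<And>n z S. \<lbrakk>z \<in> Q; cylinder {..<n} S\<rbrakk> \<Longrightarrow>
      1/2 * q {x \<in> carrier GX. z \<otimes>\<^bsub>GX\<^esub> x \<in> S} \<le> q (S \<inter> carrier GX)"
    by simp_all
  let ?L = "\<Pi>\<^sub>E k\<in>UNIV. L k" and ?M = "\<Pi>\<^sub>E k\<in>UNIV. M k"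
  have L': "closedin TX ?L" unfolding TX_def by (intro closedin_product_topology[THEN iffD2]) (use L in auto)
  have M': "closedin TX ?M" "compactin TX ?M" unfolding TX_def using M
    by (auto simp: closedin_product_topology compactin_PiE)
  have rc: "regular_content TX ?M (cylinder_content T q)"
    unfolding TX_def using q(1,2) X.regular_space[unfolded TX_def] M'[unfolded TX_def]
    by (rule regular_content_cylinder_content)
  have LM: "?L \<subseteq> ?M" using M(3) by (intro PiE_mono)
  \<comment> \<open>Every open cylinder that contains the product of the \<open>L k\<close> has
    \<open>q\<close>-value at least 1/2.\<close>
  have pos: "0 < cylinder_content T q ?L"
  proof -
    have "ennreal (1/2) \<le> cylinder_content T q ?L"
      by (rule cylinder_content_greatest) (intro ennreal_leI q(3))
    moreover have "0 < ennreal (1/2)" by (simp only: ennreal_less_zero_iff)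
    ultimately show ?thesis by (rule less_le_trans[rotated])
  qed
  have trans: "(\<lambda>x. z \<otimes>\<^bsub>GX\<^esub> x) ` ?L \<subseteq> ?M" if z: "z \<in> Q" for z
  proof (rule image_subsetI)
    fix x assume x: "x \<in> ?L"
    have "z k \<otimes>\<^bsub>G k\<^esub> x k \<in> M k" for k
    proof -
      have "z k \<in> V k" "x k \<in> L k" using QV[of k] z x by auto
      then have "z k \<otimes>\<^bsub>G k\<^esub> x k \<in> V k <#>\<^bsub>G k\<^esub> L k" unfolding set_mult_def by blast
      then show ?thesis using M(4) by blast
    qed
    then show "z \<otimes>\<^bsub>GX\<^esub> x \<in> ?M" by (simp add: GX_def PiE_iff)
  qed
  have quasi: "cylinder_content T q C \<le> 2 * cylinder_content T q ((\<lambda>x. z \<otimes>\<^bsub>GX\<^esub> x) ` C)"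
    if z: "z \<in> Q" and C: "closedin TX C" for z C
  proof -
    have half: "ennreal (1/2) * cylinder_content T q C \<le> cylinder_content T q ((\<lambda>x. z \<otimes>\<^bsub>GX\<^esub> x) ` C)"
    proof (rule cylinder_content_greatest)
      fix W assume W: "open_cylinder T W" "(\<lambda>x. z \<otimes>\<^bsub>GX\<^esub> x) ` C \<subseteq> W"
      obtain J S where J: "finite J" "cylinder J S" "W = topspace TX \<inter> S"
        using W(1) unfolding open_cylinder_def TX_def by blast
      then have WS: "W = S \<inter> carrier GX" using X.topspace_eq by auto
      obtain n where n: "J \<subseteq> {..<n}" using J(1) finite_nat_iff_bounded by auto
      let ?W = "{x \<in> carrier GX. z \<otimes>\<^bsub>GX\<^esub> x \<in> S}"
      have zc: "z \<in> carrier GX" using z QX by auto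
      have W': "?W = {x \<in> carrier GX. z \<otimes>\<^bsub>GX\<^esub> x \<in> W}" using X.m_closed[OF zc] WS by auto
      \<comment> \<open>Multiplication is coordinatewise, so the preimage of \<open>S\<close>
        depends on the same coordinates \<open>J\<close>.\<close>
      have "open_cylinder T ?W"
        unfolding open_cylinder_def
      proof (intro conjI exI)
        show "openin (product_topology T UNIV) ?W"
          unfolding W' using X.openin_translation_preimage[OF zc, of W] W(1)
          by (simp add: open_cylinder_def TX_def)
        show "finite J" by fact
        show "cylinder J {x. z \<otimes>\<^bsub>GX\<^esub> x \<in> S}"
          using J(2) unfolding cylinder_def GX_def by simp
        show "?W = topspace (product_topology T UNIV) \<inter> {x. z \<otimes>\<^bsub>GX\<^esub> x \<in> S}"
          using X.topspace_eq unfolding TX_def by auto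
      qed
      moreover have "C \<subseteq> ?W"
        using W(2) closedin_subset[OF C] X.topspace_eq unfolding WS by auto
      ultimately have "cylinder_content T q C \<le> ennreal (q ?W)" by (rule cylinder_content_le)
      then have "ennreal (1/2) * cylinder_content T q C \<le> ennreal (1/2) * ennreal (q ?W)"
        by (rule mult_left_mono) simp
      also have "\<dots> = ennreal (1/2 * q ?W)" by (rule ennreal_mult[symmetric]) (simp_all add: q(1))
      also have "\<dots> \<le> ennreal (q W)"
        unfolding WS using q(4)[OF z cylinder_mono[OF J(2) n]] by (rule ennreal_leI)
      finally show "ennreal (1/2) * cylinder_content T q C \<le> ennreal (q W)" .
    qed
    have "cylinder_content T q C = (2 * ennreal (1/2)) * cylinder_content T q C"
    proof -
      have "2 * ennreal (1/2) = ennreal (2 * (1/2))" by (subst ennreal_mult) auto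
      then show ?thesis by simp
    qed
    also have "\<dots> = 2 * (ennreal (1/2) * cylinder_content T q C)" by (simp add: mult.assoc)
    also have "\<dots> \<le> 2 * cylinder_content T q ((\<lambda>x. z \<otimes>\<^bsub>GX\<^esub> x) ` C)"
      by (rule mult_left_mono[OF half]) simp
    finally show ?thesis .
  qed
  show ?thesis
    by (intro exI[of _ ?M] exI[of _ "cylinder_content T q"] exI[of _ ?L] conjI ballI allI impI rc L' LM pos trans quasi)
qed


section \<open>Positive translates and the main theorem\<close>

lemma homeomorphic_map_measurable:
  assumes \<nu>: "borel_prob_measure_on T \<nu>" and h: "homeomorphic_map T T h"
  shows "h \<in> measurable \<nu> \<nu>"
proof (rule measurable_sigma_sets)
  have space: "space \<nu> = topspace T" using \<nu> by (simp add: borel_prob_measure_on_def)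
  have cont: "continuous_map T T h" using h by (rule homeomorphic_imp_continuous_map)
  show "sets \<nu> = sigma_sets (topspace T) {U. openin T U}"
    using \<nu> by (simp add: borel_prob_measure_on_def)
  show "{U. openin T U} \<subseteq> Pow (topspace T)" by (auto dest: openin_subset)
  show "h \<in> space \<nu> \<rightarrow> topspace T"
    using continuous_map_funspace[OF cont] by (simp add: space)
  fix U assume "U \<in> {U. openin T U}"
  then have "openin T {x \<in> topspace T. h x \<in> U}"
    using cont by (intro openin_continuous_map_preimage) auto
  moreover have "h -` U \<inter> space \<nu> = {x \<in> topspace T. h x \<in> U}" by (auto simp: space)
  ultimately show "h -` U \<inter> space \<nu> \<in> sets \<nu>"
    using \<nu> by (simp add: borel_prob_measure_on_def sigma_sets.Basic)
qed

lemma radon_prob_measure_on_distr: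
  assumes \<nu>: "radon_prob_measure_on T \<nu>" and h: "homeomorphic_map T T h"
  shows "radon_prob_measure_on T (distr \<nu> \<nu> h)"
proof -
  have b: "borel_prob_measure_on T \<nu>" using \<nu> by (simp add: radon_prob_measure_on_def)
  have space: "space \<nu> = topspace T" using b by (simp add: borel_prob_measure_on_def)
  obtain g where hg: "homeomorphic_maps T T h g" using h homeomorphic_map_maps by blast
  have g: "homeomorphic_map T T g"
    using hg homeomorphic_maps_sym homeomorphic_maps_imp_map by blast
  have gh: "\<And>x. x \<in> topspace T \<Longrightarrow> g (h x) = x" "\<And>x. x \<in> topspace T \<Longrightarrow> h (g x) = x"
    using hg by (auto simp: homeomorphic_maps_def)
  have cont: "continuous_map T T h" "continuous_map T T g"
    using h g by (auto intro: homeomorphic_imp_continuous_map)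
  have mh: "h \<in> measurable \<nu> \<nu>" and mg: "g \<in> measurable \<nu> \<nu>"
    using homeomorphic_map_measurable[OF b] h g by auto
  have hX: "\<And>x. x \<in> topspace T \<Longrightarrow> h x \<in> topspace T" "\<And>x. x \<in> topspace T \<Longrightarrow> g x \<in> topspace T"
    using continuous_map_funspace[OF cont(1)] continuous_map_funspace[OF cont(2)] by auto
  show ?thesis
    unfolding radon_prob_measure_on_def
  proof (intro conjI ballI allI impI)
    have "h -` topspace T \<inter> space \<nu> = topspace T" using hX by (auto simp: space)
    moreover have "topspace T \<in> sets \<nu>" using space by (metis sets.top)
    ultimately show "borel_prob_measure_on T (distr \<nu> \<nu> h)"
      using b mh by (simp add: borel_prob_measure_on_def emeasure_distr)
    fix B and \<epsilon> :: real assume B: "B \<in> sets (distr \<nu> \<nu> h)" and \<epsilon>: "0 < \<epsilon>"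
    then have Bs: "B \<in> sets \<nu>" by simp
    have "h -` B \<inter> space \<nu> \<in> sets \<nu>" using mh Bs by (rule measurable_sets)
    then obtain K where K: "compactin T K" "K \<in> sets \<nu>" "K \<subseteq> h -` B \<inter> space \<nu>"
      "measure \<nu> ((h -` B \<inter> space \<nu>) - K) < \<epsilon>"
      using \<nu> \<epsilon> unfolding radon_prob_measure_on_def by blast
    have KX: "K \<subseteq> topspace T" using K(1) by (rule compactin_subset_topspace)
    \<comment> \<open>Written as a preimage under the inverse homeomorphism, the image of
      \<open>K\<close> is seen to be Borel.\<close>
    have im: "h ` K = g -` K \<inter> space \<nu>"
      using KX gh hX by (force simp: space image_iff)
    have hK: "h ` K \<in> sets \<nu>" unfolding im using mg K(2) by (rule measurable_sets)
    have "h -` (B - h ` K) \<inter> space \<nu> = (h -` B \<inter> space \<nu>) - K"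
      unfolding im using KX gh hX by (auto simp: space)
    then have "measure (distr \<nu> \<nu> h) (B - h ` K) < \<epsilon>"
      using K(4) mh Bs hK by (simp add: measure_distr)
    then show "\<exists>K. compactin T K \<and> K \<in> sets (distr \<nu> \<nu> h) \<and> K \<subseteq> B \<and> measure (distr \<nu> \<nu> h) (B - K) < \<epsilon>"
      using K hK image_compactin[OF K(1) cont(1)] by (intro exI[of _ "h ` K"]) auto
  qed
qed

text \<open>Inner regularity is applied to \<open>B \<inter> D \<inter> M\<close>: a closed subset
  of \<open>M\<close> is compact, and nothing is lost because the complement of \<open>M\<close> is
  null.\<close>

lemma (in regular_content) radon_prob_measure_on_uniform_measure:
  assumes D: "D \<in> sets radon_measure" "0 < emeasure radon_measure D"
  shows "radon_prob_measure_on T (uniform_measure radon_measure D)"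
proof -
  interpret finite_measure radon_measure by (rule finite_measure_radon_measure)
  let ?\<nu> = "uniform_measure radon_measure D"
  have DX: "D \<subseteq> topspace T" using sets.sets_into_space[OF D(1)] by (simp add: space_radon_measure)
  have X: "topspace T \<in> sets radon_measure" by (rule openin_sets_radon_measure) simp
  have fin: "emeasure radon_measure D \<noteq> \<infinity>" using emeasure_finite[of D] by simp
  have pos: "0 < measure radon_measure D" using D(2) by (simp add: emeasure_eq_measure)
  show ?thesis
    unfolding radon_prob_measure_on_def
  proof (intro conjI ballI allI impI)
    have "emeasure ?\<nu> (topspace T) = 1"
      using emeasure_uniform_measure[OF D(1) X] DX pos
      by (simp add: Int_absorb2 emeasure_eq_measure divide_ennreal)
    then show "borel_prob_measure_on T ?\<nu>"
      by (simp add: borel_prob_measure_on_def space_radon_measure sets_radon_measure)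
    fix B and \<epsilon> :: real assume "B \<in> sets ?\<nu>" and \<epsilon>: "0 < \<epsilon>"
    then have B: "B \<in> sets radon_measure" by simp
    have M: "M \<in> sets radon_measure" by (rule closedin_sets_radon_measure) (rule closedin_M)
    have BDM: "B \<inter> D \<inter> M \<in> sets radon_measure" using B D(1) M by auto
    \<comment> \<open>The tolerance is multiplied by the measure of \<open>D\<close>, since
      conditioning on \<open>D\<close> divides by it.\<close>
    obtain C where C: "closedin T C" "C \<subseteq> B \<inter> D \<inter> M"
      "measure radon_measure ((B \<inter> D \<inter> M) - C) < \<epsilon> * measure radon_measure D"
      using radon_measure_inner_regular[OF BDM, of "\<epsilon> * measure radon_measure D"] \<epsilon> pos by auto
    have Cs: "C \<in> sets radon_measure" by (rule closedin_sets_radon_measure) (rule C)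
    have null: "measure radon_measure (topspace T - M) = 0"
      using emeasure_radon_measure_outside by (simp add: emeasure_eq_measure)
    have "measure radon_measure (D \<inter> (B - C))
        \<le> measure radon_measure (((B \<inter> D \<inter> M) - C) \<union> (topspace T - M))"
      using DX BDM Cs X M by (intro finite_measure_mono) auto
    also have "\<dots> \<le> measure radon_measure ((B \<inter> D \<inter> M) - C) + measure radon_measure (topspace T - M)"
      using BDM Cs X M by (intro measure_Un_le) auto
    finally have "measure radon_measure (D \<inter> (B - C)) < \<epsilon> * measure radon_measure D"
      using C(3) null by simp
    then have "measure ?\<nu> (B - C) < \<epsilon>"
      using D B Cs pos fin by (subst measure_uniform_measure) (auto simp: field_simps)
    then show "\<exists>K. compactin T K \<and> K \<in> sets ?\<nu> \<and> K \<subseteq> B \<and> measure ?\<nu> (B - K) < \<epsilon>"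
      using C Cs by (intro exI[of _ C]) (auto intro: closedin_subset_compact)
  qed
qed

text \<open>Since \<nu> does not witness Haar-nullity, some translate of \<open>E\<close> lies in no
  \<nu>-null set. Universal measurability concerns \<open>E\<close> itself, so it is used for the
  measure \<nu> shifted back by \<open>inv x\<close>; the Borel part of \<open>E\<close> then has
  positive measure after translation.\<close>

lemma (in abelian_top_group) not_haar_null_positive_translate:
  assumes E: "universally_measurable_in T E" "\<not> haar_null G T E" and \<nu>: "radon_prob_measure_on T \<nu>"
  obtains x S where "x \<in> carrier G" "S \<in> sets \<nu>" "S \<subseteq> E #> x" "0 < emeasure \<nu> S"
proof -
  have b: "borel_prob_measure_on T \<nu>" using \<nu> by (simp add: radon_prob_measure_on_def)
  have space: "space \<nu> = carrier G" using b by (simp add: borel_prob_measure_on_def topspace_eq)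
  have EG: "E \<subseteq> carrier G" using E(1) by (simp add: universally_measurable_in_def topspace_eq)
  obtain x where x: "x \<in> carrier G" and no: "\<And>N. N \<in> null_sets \<nu> \<Longrightarrow> \<not> E #> x \<subseteq> N"
    using E b unfolding haar_null_def by blast
  let ?h = "\<lambda>y. inv x \<otimes> y"
  have h: "homeomorphic_map T T ?h" using x by (intro homeomorphic_map_translation) simp
  have mh: "?h \<in> measurable \<nu> \<nu>" by (rule homeomorphic_map_measurable[OF b h])
  have "E \<in> sets (completion (distr \<nu> \<nu> ?h))"
    using E(1) radon_prob_measure_on_distr[OF \<nu> h] by (simp add: universally_measurable_in_def)
  then obtain S N N' where S: "E = S \<union> N" "N \<subseteq> N'" "N' \<in> null_sets (distr \<nu> \<nu> ?h)" "S \<in> sets (distr \<nu> \<nu> ?h)"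
    by (rule sets_completionE)
  define S1 where "S1 = ?h -` S \<inter> space \<nu>"
  define N1 where "N1 = ?h -` N' \<inter> space \<nu>"
  have S1: "S1 \<in> sets \<nu>" unfolding S1_def using S by (intro measurable_sets[OF mh]) simp
  have N1: "N1 \<in> null_sets \<nu>" unfolding N1_def using S(3) mh
    by (auto simp: null_sets_def emeasure_distr intro: measurable_sets)
  have "E #> x \<subseteq> S1 \<union> N1"
  proof
    fix y assume "y \<in> E #> x"
    then obtain e where e: "e \<in> E" "y = e \<otimes> x" by (auto simp: r_coset_def)
    then have ec: "e \<in> carrier G" using EG by auto
    then have "inv x \<otimes> y = e" using x e by (simp add: m_ac)
    then show "y \<in> S1 \<union> N1" using e S x ec unfolding S1_def N1_def space by auto
  qed
  then have "S1 \<notin> null_sets \<nu>" using no[of "S1 \<union> N1"] N1 null_sets.Un[of S1 \<nu> N1] by blast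
  then have "0 < emeasure \<nu> S1" using S1 by (auto simp: null_sets_def zero_less_iff_neq_zero)
  moreover have "S1 \<subseteq> E #> x"
  proof
    fix y assume "y \<in> S1"
    then have y: "y \<in> carrier G" "inv x \<otimes> y \<in> E" using S unfolding S1_def space by auto
    have "inv x \<otimes> y \<otimes> x = x \<otimes> (inv x \<otimes> y)" using x y by (intro m_comm) auto
    then have "y = (inv x \<otimes> y) \<otimes> x" using x y by (simp add: m_assoc[symmetric])
    then show "y \<in> E #> x" using y by (auto simp: r_coset_def)
  qed
  ultimately show thesis using that x S1 by blast
qed

text \<open>An open \<open>W\<close> around \<open>C\<close> of measure below 3/2 that of
  \<open>C\<close> also contains \<open>z C\<close> for \<open>z\<close> near the identity. As
  \<open>z C\<close> has at least half the measure of \<open>C\<close>, the two cannot be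
  disjoint.\<close>

lemma (in abelian_top_group) overlap_of_small_translates:
  assumes rc: "regular_content T M \<kappa>" and C: "closedin T C" "C \<subseteq> M" "0 < \<kappa> C"
    and quasi: "\<And>z. z \<in> Q \<Longrightarrow> (\<lambda>x. z \<otimes> x) ` C \<subseteq> M \<and> \<kappa> C \<le> 2 * \<kappa> ((\<lambda>x. z \<otimes> x) ` C)"
    and Q: "Q \<subseteq> carrier G"
  obtains N where "openin T N" "\<one> \<in> N" "\<forall>z\<in>Q \<inter> N. (\<lambda>x. z \<otimes> x) ` C \<inter> C \<noteq> {}"
proof -
  interpret C: regular_content T M \<kappa> by (rule rc)
  interpret finite_measure C.radon_measure by (rule C.finite_measure_radon_measure)
  let ?\<mu> = "measure C.radon_measure"
  have Cs: "C \<in> sets C.radon_measure" using C(1) by (rule C.closedin_sets_radon_measure)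
  have "0 < ennreal (?\<mu> C)"
    using C.emeasure_radon_measure_closed[OF C(1,2)] C(3) by (simp add: emeasure_eq_measure del: ennreal_less_zero_iff)
  then have pos: "0 < ?\<mu> C" by (simp only: ennreal_less_zero_iff)
  have compl: "topspace T - C \<in> sets C.radon_measure"
    using C(1) by (intro C.openin_sets_radon_measure) (simp add: closedin_def)
  \<comment> \<open>Outer approximation of \<open>C\<close> by an open set, obtained as inner
    approximation of its complement.\<close>
  obtain D where D: "closedin T D" "D \<subseteq> topspace T - C" "?\<mu> ((topspace T - C) - D) < ?\<mu> C / 2"
    using C.radon_measure_inner_regular[OF compl, of "?\<mu> C / 2"] pos by auto
  define W where "W = topspace T - D"
  have W: "openin T W" "C \<subseteq> W"
    using D closedin_subset[OF C(1)] by (auto simp: W_def closedin_def)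
  have Ws: "W \<in> sets C.radon_measure" using W(1) by (rule C.openin_sets_radon_measure)
  have "W - C = (topspace T - C) - D" by (auto simp: W_def)
  then have W_small: "?\<mu> W < ?\<mu> C + ?\<mu> C / 2"
    using D(3) finite_measure_Diff[OF Ws Cs W(2)] by simp
  obtain N where N: "openin T N" "\<one> \<in> N" "\<forall>z\<in>N. \<forall>c\<in>C. z \<otimes> c \<in> W"
    by (rule small_translates[OF C.closedin_subset_compact[OF C(1,2)] W])
  show thesis
  proof (rule that[OF N(1,2)], rule ballI)
    fix z assume z: "z \<in> Q \<inter> N"
    let ?zC = "(\<lambda>x. z \<otimes> x) ` C"
    have "z \<in> carrier G" using z Q by auto
    then have zC: "closedin T ?zC"
      using homeomorphic_map_closedness_eq[OF homeomorphic_map_translation] C(1) closedin_subset[OF C(1)] by blast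
    have zCs: "?zC \<in> sets C.radon_measure" using zC by (rule C.closedin_sets_radon_measure)
    have q: "?zC \<subseteq> M" "\<kappa> C \<le> 2 * \<kappa> ?zC" using quasi z by auto
    have "emeasure C.radon_measure C \<le> 2 * emeasure C.radon_measure ?zC"
      using q(2) by (simp add: C.emeasure_radon_measure_closed C(1,2) zC q(1))
    then have le: "?\<mu> C \<le> 2 * ?\<mu> ?zC"
      by (simp add: emeasure_eq_measure ennreal_mult[symmetric] flip: ennreal_numeral)
    show "?zC \<inter> C \<noteq> {}"
    proof
      assume "?zC \<inter> C = {}"
      then have "?\<mu> ?zC + ?\<mu> C = ?\<mu> (?zC \<union> C)"
        using zCs Cs by (intro finite_measure_Union[symmetric]) auto
      also have "\<dots> \<le> ?\<mu> W"
        using W(2) N(3) z Ws by (intro finite_measure_mono) auto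
      finally show False using W_small le by simp
    qed
  qed
qed

theorem mainTheorem1:
  fixes G :: "nat \<Rightarrow> ('a, 'm) monoid_scheme"
    and T :: "nat \<Rightarrow> 'a topology"
    and A B :: "(nat \<Rightarrow> 'a) set"
  defines "GX \<equiv> product_group UNIV G"
    and "TX \<equiv> product_topology T UNIV"
  assumes "\<And>n. abelian_topological_group (G n) (T n)"
    and "\<And>n. locally_compact_space (T n)"
    and "universally_measurable_in TX A"
    and "universally_measurable_in TX B"
    and "\<not> haar_null GX TX A"
    and "\<not> haar_null GX TX B"
  shows "haar_open GX TX (A <#>\<^bsub>GX\<^esub> B)"
proof -
  interpret X: abelian_top_group GX TX
    unfolding GX_def TX_def abelian_top_group_iff
    by (rule abelian_topological_group_product) (rule assms)
  have AX: "A \<subseteq> carrier GX" and BX: "B \<subseteq> carrier GX"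
    using assms(5,6) by (auto simp: universally_measurable_in_def X.topspace_eq)
  show ?thesis
    unfolding haar_open_def
  proof (intro conjI allI impI)
    show "A <#>\<^bsub>GX\<^esub> B \<subseteq> topspace TX"
      unfolding X.topspace_eq using AX BX by (rule X.set_mult_closed)
    fix K x0 assume K: "compactin TX K \<and> x0 \<in> K"
    have KX: "K \<subseteq> carrier GX" using compactin_subset_topspace[of TX K] K X.topspace_eq by simp
    have x0: "x0 \<in> K" "x0 \<in> carrier GX" using K KX by auto
    let ?t = "\<lambda>x. inv\<^bsub>GX\<^esub> x0 \<otimes>\<^bsub>GX\<^esub> x"
    \<comment> \<open>Moving \<open>x0\<close> to the identity: points of \<open>K\<close> near
      \<open>x0\<close> correspond to elements of \<open>Q\<close> near the identity.\<close>
    define Q where "Q = ?t ` K"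
    have t: "homeomorphic_map TX TX ?t" using x0 by (intro X.homeomorphic_map_translation) simp
    have Q: "compactin TX Q" unfolding Q_def
      using K t by (auto intro: image_compactin homeomorphic_imp_continuous_map)
    have QX: "Q \<subseteq> carrier GX" using compactin_subset_topspace[OF Q] X.topspace_eq by simp
    obtain M \<kappa> L where rc: "regular_content TX M \<kappa>" and L: "closedin TX L" "L \<subseteq> M" "0 < \<kappa> L"
      and trans: "\<forall>z\<in>Q. (\<lambda>x. z \<otimes>\<^bsub>GX\<^esub> x) ` L \<subseteq> M"
      and quasi: "\<forall>z\<in>Q. \<forall>C. closedin TX C \<longrightarrow> \<kappa> C \<le> 2 * \<kappa> ((\<lambda>x. z \<otimes>\<^bsub>GX\<^esub> x) ` C)"
      using ex_quasi_inv_regular_content[OF assms(3,4) Q[unfolded TX_def], folded GX_def TX_def]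
      by (elim exE conjE)
    interpret R: regular_content TX M \<kappa> by (rule rc)
    interpret finite_measure R.radon_measure by (rule R.finite_measure_radon_measure)
    let ?\<mu> = "R.radon_measure"
    have Ls: "L \<in> sets ?\<mu>" "0 < emeasure ?\<mu> L"
      using L by (auto simp: R.closedin_sets_radon_measure R.emeasure_radon_measure_closed)
    obtain a S1 where a: "a \<in> carrier GX" "S1 \<in> sets (uniform_measure ?\<mu> L)" "S1 \<subseteq> A #>\<^bsub>GX\<^esub> a"
      "0 < emeasure (uniform_measure ?\<mu> L) S1"
      by (rule X.not_haar_null_positive_translate[OF assms(5,7) R.radon_prob_measure_on_uniform_measure[OF Ls]])
    define D where "D = L \<inter> S1"
    have D: "D \<in> sets ?\<mu>" "0 < emeasure ?\<mu> D"
      using a(2,4) Ls emeasure_uniform_measure[of L ?\<mu> S1]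
      by (auto simp: D_def zero_less_iff_neq_zero ennreal_divide_eq_0_iff)
    let ?i = "\<lambda>x. inv\<^bsub>GX\<^esub> x"
    let ?\<nu> = "uniform_measure ?\<mu> D"
    have \<nu>: "radon_prob_measure_on TX ?\<nu>" by (rule R.radon_prob_measure_on_uniform_measure[OF D])
    \<comment> \<open>Testing \<open>B\<close> on the image under inversion of the measure
      conditioned on \<open>D\<close> yields points of \<open>D\<close> whose inverses lie in a
      translate of \<open>B\<close>.\<close>
    obtain b S2 where b: "b \<in> carrier GX" "S2 \<in> sets (distr ?\<nu> ?\<nu> ?i)" "S2 \<subseteq> B #>\<^bsub>GX\<^esub> b"
      "0 < emeasure (distr ?\<nu> ?\<nu> ?i) S2"
      by (rule X.not_haar_null_positive_translate[OF assms(6,8)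
          radon_prob_measure_on_distr[OF \<nu> X.homeomorphic_map_inv]])
    have mi: "?i \<in> measurable ?\<nu> ?\<nu>"
      using \<nu> X.homeomorphic_map_inv by (intro homeomorphic_map_measurable) (auto simp: radon_prob_measure_on_def)
    define S3 where "S3 = ?i -` S2 \<inter> space ?\<nu>"
    have S3: "S3 \<in> sets ?\<nu>" unfolding S3_def using b(2) by (intro measurable_sets[OF mi]) simp
    have S3_pos: "0 < emeasure ?\<nu> S3"
      using b(2,4) mi by (simp add: emeasure_distr S3_def)
    define E where "E = D \<inter> S3"
    have E: "E \<in> sets ?\<mu>" "0 < emeasure ?\<mu> E"
      using S3 S3_pos D emeasure_uniform_measure[of D ?\<mu> S3]
      by (auto simp: E_def zero_less_iff_neq_zero ennreal_divide_eq_0_iff)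
    have E_pos: "0 < measure ?\<mu> E" using E(2) by (simp add: emeasure_eq_measure)
    \<comment> \<open>The tolerance is the full measure of \<open>E\<close>, which just ensures that
      \<open>C\<close> has positive measure.\<close>
    obtain C where C: "closedin TX C" "C \<subseteq> E" "measure ?\<mu> (E - C) < measure ?\<mu> E"
      by (rule R.radon_measure_inner_regular[OF E(1) E_pos])
    have CL: "C \<subseteq> L" "C \<subseteq> M" using C(2) L(2) by (auto simp: E_def D_def)
    have Cs: "C \<in> sets ?\<mu>" using C(1) by (rule R.closedin_sets_radon_measure)
    have "0 < measure ?\<mu> C" using C(3) finite_measure_Diff[OF E(1) Cs C(2)] by simp
    then have "0 < \<kappa> C"
      using R.emeasure_radon_measure_closed[OF C(1) CL(2)] by (metis ennreal_less_zero_iff emeasure_eq_measure)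
    \<comment> \<open>\<open>C\<close> lies in \<open>L\<close>, whose translates by
      \<open>Q\<close> stay in \<open>M\<close>; there the content and the measure agree on closed
      sets.\<close>
    moreover have "(\<lambda>x. z \<otimes>\<^bsub>GX\<^esub> x) ` C \<subseteq> M \<and> \<kappa> C \<le> 2 * \<kappa> ((\<lambda>x. z \<otimes>\<^bsub>GX\<^esub> x) ` C)" if "z \<in> Q" for z
      using trans quasi that C(1) CL(1) by blast
    ultimately obtain N where N: "openin TX N" "\<one>\<^bsub>GX\<^esub> \<in> N"
      "\<forall>z\<in>Q \<inter> N. (\<lambda>x. z \<otimes>\<^bsub>GX\<^esub> x) ` C \<inter> C \<noteq> {}"
      by (rule X.overlap_of_small_translates[OF rc C(1) CL(2) _ _ QX])
    define U where "U = K \<inter> {x \<in> carrier GX. ?t x \<in> N}"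
    define y where "y = a \<otimes>\<^bsub>GX\<^esub> b \<otimes>\<^bsub>GX\<^esub> x0"
    have "openin (subtopology TX K) U"
      unfolding U_def using N(1) x0
      by (intro openin_subtopology_Int2 X.openin_translation_preimage) auto
    moreover have "x0 \<in> U" using x0 N(2) by (simp add: U_def)
    moreover have "U \<subseteq> (A <#>\<^bsub>GX\<^esub> B) #>\<^bsub>GX\<^esub> y"
    proof
      fix u assume u: "u \<in> U"
      then have "?t u \<in> Q \<inter> N" by (auto simp: U_def Q_def)
      from bspec[OF N(3) this] obtain c where c: "c \<in> C" "?t u \<otimes>\<^bsub>GX\<^esub> c \<in> C" by blast
      have uc: "u \<in> carrier GX" using u by (simp add: U_def)
      have cc: "c \<in> carrier GX" using c(1) closedin_subset[OF C(1)] X.topspace_eq by auto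
      have "?t u \<otimes>\<^bsub>GX\<^esub> c \<in> A #>\<^bsub>GX\<^esub> a" using c(2) C(2) a(3) by (auto simp: E_def D_def)
      then obtain \<alpha> where \<alpha>: "\<alpha> \<in> A" "?t u \<otimes>\<^bsub>GX\<^esub> c = \<alpha> \<otimes>\<^bsub>GX\<^esub> a" by (auto simp: r_coset_def)
      have "?i c \<in> B #>\<^bsub>GX\<^esub> b" using c(1) C(2) b(3) by (auto simp: E_def S3_def)
      then obtain \<beta> where \<beta>: "\<beta> \<in> B" "?i c = \<beta> \<otimes>\<^bsub>GX\<^esub> b" by (auto simp: r_coset_def)
      have \<alpha>\<beta>: "\<alpha> \<in> carrier GX" "\<beta> \<in> carrier GX" using \<alpha> \<beta> AX BX by auto
      \<comment> \<open>With \<open>z = ?t u\<close>, the element \<open>z c\<close> lies in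
        \<open>A a\<close> and the inverse of \<open>c\<close> in \<open>B b\<close>. Hence
        \<open>z\<close> is in \<open>A B a b\<close>, and multiplying by \<open>x0\<close> gives
        the translate by \<open>y\<close>.\<close>
      have "u = x0 \<otimes>\<^bsub>GX\<^esub> ((?t u \<otimes>\<^bsub>GX\<^esub> c) \<otimes>\<^bsub>GX\<^esub> ?i c)"
        using uc cc x0 by (simp add: X.m_assoc) (simp add: X.m_assoc[symmetric])
      also have "\<dots> = (\<alpha> \<otimes>\<^bsub>GX\<^esub> \<beta>) \<otimes>\<^bsub>GX\<^esub> y"
        unfolding \<alpha>(2) \<beta>(2) y_def using \<alpha>\<beta> a(1) b(1) x0 by (simp add: X.m_ac)
      finally show "u \<in> (A <#>\<^bsub>GX\<^esub> B) #>\<^bsub>GX\<^esub> y"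
        using \<alpha>(1) \<beta>(1) unfolding r_coset_def set_mult_def by blast
    qed
    moreover have "U \<subseteq> K" by (simp add: U_def)
    moreover have "y \<in> carrier GX" using a(1) b(1) x0 by (simp add: y_def)
    ultimately show "\<exists>y\<in>carrier GX. \<exists>U. openin (subtopology TX K) U \<and> x0 \<in> U \<and> U \<subseteq> K \<inter> (A <#>\<^bsub>GX\<^esub> B #>\<^bsub>GX\<^esub> y)"
      by blast
  qed
qed


end
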